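(* There exist graphs $G_1,G_2$ such that $\mathrm{HypIso}(G_1,G_2)\neq\mathrm{Iso}(G_1,G_2)$. In particular, there is a perfect ${\rm q}$-strategy for $\mathrm{Iso}(G_1,G_2)$ that is not a perfect ${\rm q}$-strategy for $\mathrm{HypIso}(G_1,G_2)$.
   Context: Games and strategies. A non-local game over finite sets $(X,Y,A,B)$ is given by a rule function $\lambda:X\times Y\times A\times B\to\{0,1\}$: Alice receives $x\in X$ and answers $a\in A$, Bob receives $y\in Y$ and answers $b\in B$, without communicating, and they win if $\lambda(x,y,a,b)=1$. A quantum correlation is a family of conditional probabilities of the form $p(a,b|x,y)=\langle (E_{x,a}\otimes F_{y,b})\xi,\xi\rangle$, where $\xi$ is a unit vector in $H_A\otimes H_B$, with $H_A,H_B$ finite-dimensional Hilbert spaces, and $(E_{x,a})_{a\in A}$, $(F_{y,b})_{b\in B}$ are, for each $x$ and each $y$, families of positive operators on $H_A$, respectively $H_B$, summing to the identity. A perfect ${\rm q}$-strategy for the game is a quantum correlation $p$ with $p(a,b|x,y)=0$ whenever $\lambda(x,y,a,b)=0$. Graphs and hypergraphs. A hypergraph $\Lambda=(V,E)$ consists of a finite vertex set $V$ and a non-empty finite family $E$ of subsets of $V$ (hyperedges); all hypergraphs are assumed full, i.e. the union of the hyperedges is $V$. Graphs are finite and simple, and a graph $G=(V,E)$ is regarded as a hypergraph whose hyperedges are its edges. The graph isomorphism game $\mathrm{Iso}(G_1,G_2)$, for $G_i=(V_i,E_i)$ (with $V_1,V_2$ taken disjoint): questions and answers for both players are elements of $V_1\sqcup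 V_2$. A player receiving a vertex of one graph must answer with a vertex of the other graph. Among the questions and answers there are thus one vertex of $G_1$ and one vertex of $G_2$ for each player; the players win if and only if the relation (equal; distinct and adjacent; distinct and non-adjacent) between the two $V_1$-vertices is the same as the relation between the two $V_2$-vertices. The hypergraph isomorphism game $\mathrm{HypIso}(\Lambda_1,\Lambda_2)$, for $\Lambda_i=(V_i,E_i)$: questions and answers for both players are elements of $V_1\sqcup V_2\sqcup E_1\sqcup E_2$. With questions $x,y$ and answers $a,b$ of Alice and Bob respectively, the players win if and only if: (i) each answer is of the same type (vertex or hyperedge) as the question, but from the opposite hypergraph; (ii) incidence is preserved: if one question is a vertex and the other a hyperedge of the same hypergraph, the question vertex lies in the question hyperedge if and only if the answer vertex lies in the answer hyperedge; (iii) if both questions are vertices, the relation (equal; adjacent, i.e. contained in a common hyperedge; distinct non-adjacent) between the two $V_1$-vertices among $x,y,a,b$ is the same as that between the two $V_2$-vertices; (iv) if both questions are hyperedges, the relation (equal; intersecting; disjoint) between the two $E_1$-hyperedges among $x,y,a,b$ is the same as that between the two $E_2$-hyperedges. $\mathrm{HypIso}(G_1,G_2)$ is this game for the graphs $G_1,G_2$ regarded as hypergraphs. Relation between the two games. Both games are synchronous (on equal questions only equal answers win). The $*$-algebra of a synchronous game with question set $X$ and answer set $A$ is the unital $*$-algebra generated by self-adjoint idempotents $e_{x,a}$ with $\sum_{a}e_{x,a}=1$ for every $x$ and $e_{x,a}e_{y,b}=0$ whenever $\lambda(x,y,a,b)=0$. The $*$-algebra of $\mathrm{Iso}(G_1,G_2)$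 is generated by the entries $u_{v_1,v_2}$ ($v_i\in V_i$) of a magic unitary $U$ (self-adjoint idempotent entries, mutually orthogonal along each row and each column, with rows and columns summing to $1$) that satisfies $A^{(G_1)}U=UA^{(G_2)}$, where $A^{(G_i)}$ is the adjacency matrix of $G_i$. The $*$-algebra of $\mathrm{HypIso}(G_1,G_2)$ is canonically the quotient of it by the relations $u_{v_1,v_2}u_{w_1,w_2}=u_{w_1,w_2}u_{v_1,v_2}$ whenever $v_1$ is adjacent to $w_1$ in $G_1$ and $v_2$ is adjacent to $w_2$ in $G_2$. In this sense perfect strategies for $\mathrm{HypIso}(G_1,G_2)$ are regarded as perfect strategies for $\mathrm{Iso}(G_1,G_2)$, and $\mathrm{HypIso}(G_1,G_2)$ as an algebraic subgame of $\mathrm{Iso}(G_1,G_2)$; the proposition says that the two games do not coincide in general. *)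

theory Defs
  imports
    "HOL-Library.Poly_Mapping"
    "HOL-Algebra.QuotRing"
    "Jordan_Normal_Form.Matrix"
begin

section \<open>Hypergraphs and graphs\<close>

record 'v hgraph =
  vertices :: "'v set"
  hyperedges :: "'v set set"

text \<open>All hypergraphs are full: the hyperedges cover the vertex set.\<close>

definition hypergraph :: "'v hgraph \<Rightarrow> bool" where
  "hypergraph L \<longleftrightarrow> finite (vertices L) \<and> hyperedges L \<noteq> {} \<and> \<Union> (hyperedges L) = vertices L"

definition simple_graph :: "'v hgraph \<Rightarrow> bool" where
  "simple_graph G \<longleftrightarrow> finite (vertices G) \<and> (\<forall>e\<in>hyperedges G. e \<subseteq> vertices G \<and> card e = 2)"


section \<open>Non-local games and perfect quantum strategies\<close>

record ('x, 'y, 'a, 'b) game =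
  questA :: "'x set"
  questB :: "'y set"
  answA :: "'a set"
  answB :: "'b set"
  rule :: "'x \<Rightarrow> 'y \<Rightarrow> 'a \<Rightarrow> 'b \<Rightarrow> bool"

definition kronecker :: "complex mat \<Rightarrow> complex mat \<Rightarrow> complex mat" where
  "kronecker A B = mat (dim_row A * dim_row B) (dim_col A * dim_col B)
     (\<lambda>(i, j). A $$ (i div dim_row B, j div dim_col B) * B $$ (i mod dim_row B, j mod dim_col B))"

text \<open>The order on \<^typ>\<open>complex\<close> is the one in which \<open>0 \<le> z\<close> means that \<open>z\<close> is real and
  non-negative, so the condition below forces the operator to be self-adjoint.\<close>

definition positive_operator :: "nat \<Rightarrow> complex mat \<Rightarrow> bool" where
  "positive_operator n T \<longleftrightarrow> T \<in> carrier_mat n n \<and> (\<forall>v\<in>carrier_vec n. 0 \<le> (T *\<^sub>v v) \<bullet>c v)"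

definition povm :: "nat \<Rightarrow> 'a set \<Rightarrow> ('a \<Rightarrow> complex mat) \<Rightarrow> bool" where
  "povm n A E \<longleftrightarrow> (\<forall>a\<in>A. positive_operator n (E a)) \<and>
     mat n n (\<lambda>(i, j). \<Sum>a\<in>A. E a $$ (i, j)) = 1\<^sub>m n"

text \<open>Conditional probabilities \<open>p(a,b|x,y)\<close> are written \<open>p x y a b\<close>; only the values at
  arguments in the question and answer sets are meaningful.  A finite-dimensional Hilbert space is
  represented by the coordinate space of column vectors of some dimension, and the tensor product
  of two such spaces by the column vectors of the product dimension.\<close>

definition quantum_correlation ::
  "'x set \<Rightarrow> 'y set \<Rightarrow> 'a set \<Rightarrow> 'b set \<Rightarrow> ('x \<Rightarrow> 'y \<Rightarrow> 'a \<Rightarrow> 'b \<Rightarrow> real) \<Rightarrow> bool" where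
  "quantum_correlation X Y A B p \<longleftrightarrow>
     (\<exists>(m::nat) (n::nat) (\<xi>::complex vec) (E::'x \<Rightarrow> 'a \<Rightarrow> complex mat) (F::'y \<Rightarrow> 'b \<Rightarrow> complex mat).
        \<xi> \<in> carrier_vec (m * n) \<and> \<xi> \<bullet>c \<xi> = 1 \<and>
        (\<forall>x\<in>X. povm m A (E x)) \<and> (\<forall>y\<in>Y. povm n B (F y)) \<and>
        (\<forall>x\<in>X. \<forall>y\<in>Y. \<forall>a\<in>A. \<forall>b\<in>B.
           complex_of_real (p x y a b) = (kronecker (E x a) (F y b) *\<^sub>v \<xi>) \<bullet>c \<xi>))"

definition perfect_q_strategy ::
  "('x, 'y, 'a, 'b) game \<Rightarrow> ('x \<Rightarrow> 'y \<Rightarrow> 'a \<Rightarrow> 'b \<Rightarrow> real) \<Rightarrow> bool" where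
  "perfect_q_strategy G p \<longleftrightarrow>
     quantum_correlation (questA G) (questB G) (answA G) (answB G) p \<and>
     (\<forall>x\<in>questA G. \<forall>y\<in>questB G. \<forall>a\<in>answA G. \<forall>b\<in>answB G.
        \<not> rule G x y a b \<longrightarrow> p x y a b = 0)"


section \<open>The isomorphism games\<close>

datatype vertex_relation = EqualV | AdjacentV | NonadjacentV
datatype edge_relation = EqualE | IntersectingE | DisjointE

definition graph_relation :: "'v hgraph \<Rightarrow> 'v \<Rightarrow> 'v \<Rightarrow> vertex_relation" where
  "graph_relation G v w =
     (if v = w then EqualV else if {v, w} \<in> hyperedges G then AdjacentV else NonadjacentV)"

definition hypergraph_relation :: "'v hgraph \<Rightarrow> 'v \<Rightarrow> 'v \<Rightarrow> vertex_relation" where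
  "hypergraph_relation L v w =
     (if v = w then EqualV
      else if (\<exists>e\<in>hyperedges L. v \<in> e \<and> w \<in> e) then AdjacentV else NonadjacentV)"

definition hyperedge_relation :: "'v set \<Rightarrow> 'v set \<Rightarrow> edge_relation" where
  "hyperedge_relation e f =
     (if e = f then EqualE else if e \<inter> f \<noteq> {} then IntersectingE else DisjointE)"

text \<open>The sides \<^const>\<open>Inl\<close> and \<^const>\<open>Inr\<close> of a sum stand for the first and the second (hyper)graph.
  \<open>sides q r\<close> is the pair consisting of the object of the first and the object of the second
  (hyper)graph among a player's question \<open>q\<close> and answer \<open>r\<close>; it is \<^const>\<open>None\<close> if these come from
  the same (hyper)graph.\<close>

fun sides :: "'s + 't \<Rightarrow> 's + 't \<Rightarrow> ('s \<times> 't) option" where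
  "sides (Inl s) (Inr t) = Some (s, t)"
| "sides (Inr t) (Inl s) = Some (s, t)"
| "sides _ _ = None"

definition iso_rule ::
  "'v hgraph \<Rightarrow> 'w hgraph \<Rightarrow> 'v + 'w \<Rightarrow> 'v + 'w \<Rightarrow> 'v + 'w \<Rightarrow> 'v + 'w \<Rightarrow> bool" where
  "iso_rule G1 G2 x y a b \<longleftrightarrow>
     (\<exists>v1 v2 w1 w2. sides x a = Some (v1, v2) \<and> sides y b = Some (w1, w2) \<and>
        graph_relation G1 v1 w1 = graph_relation G2 v2 w2)"

definition Iso :: "'v hgraph \<Rightarrow> 'w hgraph \<Rightarrow> ('v + 'w, 'v + 'w, 'v + 'w, 'v + 'w) game" where
  "Iso G1 G2 =
     (let Q = vertices G1 <+> vertices G2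
      in \<lparr>questA = Q, questB = Q, answA = Q, answB = Q, rule = iso_rule G1 G2\<rparr>)"

text \<open>In the hypergraph game, \<^const>\<open>Inl\<close> and \<^const>\<open>Inr\<close> at the outer level distinguish vertices
  from hyperedges.  Incidence is compared only if the two questions (vertex and hyperedge) come
  from the same hypergraph.\<close>

type_synonym ('v, 'w) hyp_item = "('v + 'w) + ('v set + 'w set)"

fun hypiso_rule :: "'v hgraph \<Rightarrow> 'w hgraph \<Rightarrow>
    ('v, 'w) hyp_item \<Rightarrow> ('v, 'w) hyp_item \<Rightarrow> ('v, 'w) hyp_item \<Rightarrow> ('v, 'w) hyp_item \<Rightarrow> bool" where
  "hypiso_rule L1 L2 (Inl x) (Inl y) (Inl a) (Inl b) \<longleftrightarrow>
     (\<exists>v1 v2 w1 w2. sides x a = Some (v1, v2) \<and> sides y b = Some (w1, w2) \<and>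
        hypergraph_relation L1 v1 w1 = hypergraph_relation L2 v2 w2)"
| "hypiso_rule L1 L2 (Inr x) (Inr y) (Inr a) (Inr b) \<longleftrightarrow>
     (\<exists>e1 e2 f1 f2. sides x a = Some (e1, e2) \<and> sides y b = Some (f1, f2) \<and>
        hyperedge_relation e1 f1 = hyperedge_relation e2 f2)"
| "hypiso_rule L1 L2 (Inl x) (Inr y) (Inl a) (Inr b) \<longleftrightarrow>
     (\<exists>v1 v2 e1 e2. sides x a = Some (v1, v2) \<and> sides y b = Some (e1, e2) \<and>
        (isl x = isl y \<longrightarrow> (v1 \<in> e1 \<longleftrightarrow> v2 \<in> e2)))"
| "hypiso_rule L1 L2 (Inr x) (Inl y) (Inr a) (Inl b) \<longleftrightarrow>
     (\<exists>e1 e2 v1 v2. sides x a = Some (e1, e2) \<and> sides y b = Some (v1, v2) \<and>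
        (isl x = isl y \<longrightarrow> (v1 \<in> e1 \<longleftrightarrow> v2 \<in> e2)))"
| "hypiso_rule L1 L2 _ _ _ _ \<longleftrightarrow> False"

definition HypIso :: "'v hgraph \<Rightarrow> 'w hgraph \<Rightarrow>
    (('v, 'w) hyp_item, ('v, 'w) hyp_item, ('v, 'w) hyp_item, ('v, 'w) hyp_item) game" where
  "HypIso L1 L2 =
     (let Q = (vertices L1 <+> vertices L2) <+> (hyperedges L1 <+> hyperedges L2)
      in \<lparr>questA = Q, questB = Q, answA = Q, answB = Q, rule = hypiso_rule L1 L2\<rparr>)"


section \<open>The *-algebra of a synchronous game\<close>

text \<open>Words in the letters \<open>'g\<close>, written additively so that \<open>'g word \<Rightarrow>\<^sub>0 complex\<close>, with the
  convolution product, is the free unital complex algebra on \<open>'g\<close>.\<close>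

datatype 'g word = Word (letters: "'g list")

instantiation word :: (type) monoid_add
begin
definition zero_word :: "'g word" where "zero_word = Word []"
definition plus_word :: "'g word \<Rightarrow> 'g word \<Rightarrow> 'g word" where
  "plus_word u v = Word (letters u @ letters v)"
instance by standard (simp_all add: zero_word_def plus_word_def)
end

type_synonym 'g free_elem = "'g word \<Rightarrow>\<^sub>0 complex"

definition scalar :: "complex \<Rightarrow> 'g free_elem" where
  "scalar c = Poly_Mapping.single 0 c"

definition gen :: "'g \<Rightarrow> 'g free_elem" where
  "gen g = Poly_Mapping.single (Word [g]) 1"

text \<open>The conjugate-linear anti-multiplicative involution that fixes the generators.\<close>

definition star :: "'g free_elem \<Rightarrow> 'g free_elem" where
  "star f = Poly_Mapping.map cnj (Poly_Mapping.map_key (\<lambda>w. Word (rev (letters w))) f)"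

lemma lookup_star:
  "Poly_Mapping.lookup (star f) w = cnj (Poly_Mapping.lookup f (Word (rev (letters w))))"
proof -
  have inj: "inj (\<lambda>w::'g word. Word (rev (letters w)))"
    by (auto simp: inj_def intro: word.expand)
  have "Poly_Mapping.lookup (Poly_Mapping.map_key (\<lambda>w. Word (rev (letters w))) f) w =
      Poly_Mapping.lookup f (Word (rev (letters w)))"
    by (simp add: map_key.rep_eq[OF inj])
  then show ?thesis
    by (simp add: star_def Poly_Mapping.map.rep_eq when_def)
qed

definition free_algebra :: "'g set \<Rightarrow> 'g free_elem ring" where
  "free_algebra S =
     \<lparr>carrier = {f. \<forall>w\<in>Poly_Mapping.keys f. set (letters w) \<subseteq> S},
      monoid.mult = (*), one = 1, zero = 0, add = (+)\<rparr>"

text \<open>For a synchronous game (same questions and same answers for both players).  The generators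
  are self-adjoint because \<^const>\<open>star\<close> fixes them.\<close>

definition game_generators :: "('x, 'x, 'a, 'a) game \<Rightarrow> ('x \<times> 'a) set" where
  "game_generators G = questA G \<times> answA G"

definition game_relations :: "('x, 'x, 'a, 'a) game \<Rightarrow> ('x \<times> 'a) free_elem set" where
  "game_relations G =
     {gen (x, a) * gen (x, a) - gen (x, a) | x a. x \<in> questA G \<and> a \<in> answA G} \<union>
     {(\<Sum>a\<in>answA G. gen (x, a)) - 1 | x. x \<in> questA G} \<union>
     {gen (x, a) * gen (y, b) | x y a b. x \<in> questA G \<and> y \<in> questA G \<and>
        a \<in> answA G \<and> b \<in> answA G \<and> \<not> rule G x y a b}"

text \<open>The *-ideal generated by a set is the two-sided ideal generated by that set and its adjoints.\<close>

definition game_ideal :: "('x, 'x, 'a, 'a) game \<Rightarrow> ('x \<times> 'a) free_elem set" where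
  "game_ideal G =
     genideal (free_algebra (game_generators G)) (game_relations G \<union> star ` game_relations G)"

definition game_algebra :: "('x, 'x, 'a, 'a) game \<Rightarrow> ('x \<times> 'a) free_elem set ring" where
  "game_algebra G = free_algebra (game_generators G) Quot game_ideal G"

definition game_class :: "('x, 'x, 'a, 'a) game \<Rightarrow> ('x \<times> 'a) free_elem \<Rightarrow> ('x \<times> 'a) free_elem set" where
  "game_class G f = game_ideal G +>\<^bsub>free_algebra (game_generators G)\<^esub> f"

text \<open>Unital *-homomorphisms between game algebras.  The game ideals are invariant under
  \<^const>\<open>star\<close>, so the adjoint of a coset is its image under \<^const>\<open>star\<close>.\<close>

definition game_star_hom :: "('x, 'x, 'a, 'a) game \<Rightarrow> ('y, 'y, 'b, 'b) game \<Rightarrow>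
    (('x \<times> 'a) free_elem set \<Rightarrow> ('y \<times> 'b) free_elem set) \<Rightarrow> bool" where
  "game_star_hom G H \<phi> \<longleftrightarrow>
     \<phi> \<in> Ring.ring_hom (game_algebra G) (game_algebra H) \<and>
     (\<forall>c. \<phi> (game_class G (scalar c)) = game_class H (scalar c)) \<and>
     (\<forall>C\<in>carrier (game_algebra G). \<phi> (star ` C) = star ` \<phi> C)"

text \<open>The canonical map from the algebra of the graph isomorphism game to that of the hypergraph
  isomorphism game sends \<open>e\<^bsub>x,a\<^esub>\<close> to \<open>e\<^bsub>x,a\<^esub>\<close>, for vertices \<open>x\<close> and \<open>a\<close>; this determines
  it on the carrier.\<close>

definition canonical_iso_hypiso_map :: "'v hgraph \<Rightarrow> 'w hgraph \<Rightarrow>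
    ((('v + 'w) \<times> ('v + 'w)) free_elem set \<Rightarrow>
     (('v, 'w) hyp_item \<times> ('v, 'w) hyp_item) free_elem set) \<Rightarrow> bool" where
  "canonical_iso_hypiso_map G1 G2 \<phi> \<longleftrightarrow>
     game_star_hom (Iso G1 G2) (HypIso G1 G2) \<phi> \<and>
     (\<forall>x\<in>questA (Iso G1 G2). \<forall>a\<in>answA (Iso G1 G2).
        \<phi> (game_class (Iso G1 G2) (gen (x, a))) = game_class (HypIso G1 G2) (gen (Inl x, Inl a)))"

text \<open>A strategy for the graph isomorphism game is regarded as a perfect q-strategy for the
  hypergraph isomorphism game if it is the restriction to vertices of such a strategy.\<close>

definition perfect_q_strategy_for_HypIso :: "'v hgraph \<Rightarrow> 'w hgraph \<Rightarrow>
    ('v + 'w \<Rightarrow> 'v + 'w \<Rightarrow> 'v + 'w \<Rightarrow> 'v + 'w \<Rightarrow> real) \<Rightarrow> bool" where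
  "perfect_q_strategy_for_HypIso G1 G2 p \<longleftrightarrow>
     (\<exists>p'. perfect_q_strategy (HypIso G1 G2) p' \<and>
        (\<forall>x\<in>questA (Iso G1 G2). \<forall>y\<in>questB (Iso G1 G2).
         \<forall>a\<in>answA (Iso G1 G2). \<forall>b\<in>answB (Iso G1 G2).
           p x y a b = p' (Inl x) (Inl y) (Inl a) (Inl b)))"

end

theory Submission
  imports Defs "HOL-Library.Function_Algebras"
begin

text \<open>
  Both graphs are the complete graph \<open>K\<close> on six vertices.  Every magic unitary commutes with its
  adjacency matrix, so the algebra of \<open>Iso(K, K)\<close> is that of the quantum symmetric group on six points;
  in the algebra of \<open>HypIso(K, K)\<close>, on the other hand, all entries \<open>u\<^bsub>v,i\<^esub>\<close> of the magic unitary
  commute, so that its perfect strategies behave classically on vertices.  Both parts of the theorem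
  separate the two games by a block diagonal magic unitary with three blocks of the form
  \<open>(P, 1 - P; 1 - P, P)\<close>, where the three idempotents \<open>P\<close> need not commute.

  For the algebras, take two blocks with noncommuting idempotents.  They show that
  \<open>u\<^bsub>0,0\<^esub> u\<^bsub>2,2\<^esub> \<noteq> u\<^bsub>2,2\<^esub> u\<^bsub>0,0\<^esub>\<close> in the algebra of \<open>Iso(K, K)\<close>
  (\<open>block_representation_vanishes\<close>).  In the algebra of \<open>HypIso\<close> the two entries commute
  (\<open>HypIso_adjacent_entries_commute\<close>), because both products equal \<open>u\<^bsub>0,0\<^esub> g\<close>, where \<open>g\<close> is the
  idempotent that answers the edge \<open>{0, 2}\<close> by itself.  Hence the canonical homomorphism, which exists for all simple
  graphs (\<open>canonical_map_exists\<close>), identifies two different elements.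

  For the strategies, take as \<open>P\<close> the projections onto three lines in the plane and let the players
  share a maximally entangled state.  The probabilities for the questions \<open>0\<close>, \<open>2\<close>, \<open>4\<close> then violate Wigner's
  form of Bell's inequality.  A perfect strategy for \<open>HypIso\<close> with the same values on vertices
  would satisfy it (\<open>HypIso_Wigner_inequality\<close>): the answer to the edge \<open>{0, 2}\<close> contains the
  answers to \<open>0\<close> and to \<open>2\<close>, and since these lie in different blocks they can be told apart.  Alice's
  measurement for the edge together with Bob's measurement for \<open>4\<close> therefore yields a joint distribution
  of all three answers.  That this joint distribution has the right marginals uses more than
  no-signalling: zero probabilities become equations between vectors
  (\<open>positive_tensor_form\<close>), by which the edge measurement acts on the shared state exactly as the
  vertex measurements do (\<open>HypIso_edge_answer_refines_vertex_answer\<close>).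
\<close>

section \<open>Positive kernels and tensor products of positive operators\<close>

text \<open>Kernels on the natural numbers, of which only the first \<open>n\<close> indices count, replace matrices
  here so that an induction can drop the last index without a change of type.\<close>

definition positive_kernel :: "nat \<Rightarrow> (nat \<Rightarrow> nat \<Rightarrow> complex) \<Rightarrow> bool" where
  "positive_kernel n K \<longleftrightarrow> (\<forall>v. 0 \<le> (\<Sum>i<n. \<Sum>j<n. K i j * v j * cnj (v i)))"

lemma positive_kernel_two_points:
  assumes K: "positive_kernel n K" and i: "i < n" and j: "j < n" and ij: "i \<noteq> j"
  shows "0 \<le> K i i * (s * cnj s) + K i j * t * cnj s + K j i * s * cnj t + K j j * (t * cnj t)"
proof -
  define v where "v = (\<lambda>k. if k = i then s else if k = j then t else 0)"
  have inner: "(\<Sum>l<n. K k l * v l * cnj (v k)) = (K k i * s + K k j * t) * cnj (v k)" for k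
  proof -
    have "(\<Sum>l<n. K k l * v l * cnj (v k)) = (\<Sum>l\<in>{i,j}. K k l * v l * cnj (v k))"
      by (rule sum.mono_neutral_right) (use i j in \<open>auto simp: v_def\<close>)
    then show ?thesis using ij by (simp add: v_def algebra_simps)
  qed
  have "(\<Sum>k<n. \<Sum>l<n. K k l * v l * cnj (v k)) = (\<Sum>k<n. (K k i * s + K k j * t) * cnj (v k))"
    by (simp add: inner)
  also have "\<dots> = (\<Sum>k\<in>{i,j}. (K k i * s + K k j * t) * cnj (v k))"
    by (rule sum.mono_neutral_right) (use i j in \<open>auto simp: v_def\<close>)
  also have "\<dots> = K i i * (s * cnj s) + K i j * t * cnj s + K j i * s * cnj t + K j j * (t * cnj t)"
    using ij by (simp add: v_def algebra_simps)
  finally show ?thesis using K[unfolded positive_kernel_def, rule_format, of v] by simp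
qed

lemma positive_kernel_diagonal:
  assumes K: "positive_kernel n K" and i: "i < n"
  shows "0 \<le> K i i"
proof -
  define v where "v = (\<lambda>k. if k = i then 1 else 0 :: complex)"
  have "(\<Sum>k<n. \<Sum>l<n. K k l * v l * cnj (v k)) = (\<Sum>k\<in>{i}. \<Sum>l\<in>{i}. K k l * v l * cnj (v k))"
    by (intro sum.mono_neutral_cong_right) (use i in \<open>auto simp: v_def\<close>)
  then have "(\<Sum>k<n. \<Sum>l<n. K k l * v l * cnj (v k)) = K i i" by (simp add: v_def)
  then show ?thesis using K[unfolded positive_kernel_def, rule_format, of v] by simp
qed

text \<open>Polarization: the form is real at the two-point vectors \<open>(1, 1)\<close> and \<open>(1, \<i>)\<close>.\<close>

lemma positive_kernel_hermitian:
  assumes K: "positive_kernel n K" and i: "i < n" and j: "j < n"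
  shows "K i j = cnj (K j i)"
proof (cases "i = j")
  case True
  then show ?thesis using positive_kernel_diagonal[OF K i] by (simp add: less_eq_complex_def complex_eq_iff)
next
  case False
  note d = positive_kernel_diagonal[OF K i] positive_kernel_diagonal[OF K j]
  note two = positive_kernel_two_points[OF K i j False]
  show ?thesis
    using d two[of 1 1] two[of 1 \<i>] by (simp add: less_eq_complex_def complex_eq_iff)
qed

text \<open>If \<open>K i i = 0\<close>, then the form at a two-point vector is affine in the coordinate at \<open>i\<close>, so it can be
  made negative unless the mixed term vanishes.\<close>

lemma positive_kernel_null_row:
  assumes K: "positive_kernel n K" and i: "i < n" and j: "j < n" and z: "K i i = 0"
  shows "K i j = 0"
proof (cases "i = j")
  case False
  have h: "K i j = cnj (K j i)" by (rule positive_kernel_hermitian[OF K i j])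
  have dj: "0 \<le> Re (K j j)" using positive_kernel_diagonal[OF K j] by (auto simp: less_eq_complex_def)
  have bound: "2 * r * (cmod (K i j))\<^sup>2 \<le> Re (K j j)" for r
  proof -
    have "0 \<le> Re (K i j * cnj (- of_real r * K i j) + K j i * (- of_real r * K i j) + K j j)"
      using positive_kernel_two_points[OF K i j False, of "- of_real r * K i j" 1] z
      by (simp add: less_eq_complex_def)
    also have "K i j * cnj (- of_real r * K i j) + K j i * (- of_real r * K i j) + K j j
        = K j j - of_real (2 * r) * (K i j * cnj (K i j))"
      using h by (simp add: algebra_simps)
    also have "Re \<dots> = Re (K j j) - 2 * r * (cmod (K i j))\<^sup>2"
      by (simp only: complex_norm_square[symmetric] minus_complex.sel of_real_mult[symmetric] Re_complex_of_real)
    finally show ?thesis by simp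
  qed
  show ?thesis
  proof (rule ccontr)
    assume "K i j \<noteq> 0"
    then have "2 * ((Re (K j j) + 1) / (cmod (K i j))\<^sup>2) * (cmod (K i j))\<^sup>2 = 2 * (Re (K j j) + 1)"
      by simp
    then have "2 * (Re (K j j) + 1) \<le> Re (K j j)"
      using bound[of "(Re (K j j) + 1) / (cmod (K i j))\<^sup>2"] by simp
    with dj show False by simp
  qed
qed (use i j z in simp)

text \<open>The Cholesky decomposition.  Subtracting the rank-one kernel built from the last column leaves a
  positive kernel whose last row and column vanish, and the induction continues with one index less.
  A zero pivot is harmless because its whole row vanishes.\<close>

lemma positive_kernel_gram:
  assumes "positive_kernel n K"
  obtains N :: nat and a :: "nat \<Rightarrow> nat \<Rightarrow> complex"
  where "\<And>i j. i < n \<Longrightarrow> j < n \<Longrightarrow> K i j = (\<Sum>k<N. a k i * cnj (a k j))"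
proof -
  have "\<exists>N a. \<forall>i<n. \<forall>j<n. K i j = (\<Sum>k<N::nat. a k i * cnj (a k j))"
    using assms
  proof (induction n arbitrary: K)
    case 0
    then show ?case by simp
  next
    case (Suc n)
    note K = Suc.prems
    have herm: "K i j = cnj (K j i)" if "i < Suc n" "j < Suc n" for i j
      using positive_kernel_hermitian[OF K that] .
    define d where "d = K n n"
    have d: "0 \<le> Re d" "d = of_real (Re d)"
      using positive_kernel_diagonal[OF K, of n] by (auto simp: d_def less_eq_complex_def complex_eq_iff)
    define b where "b = (\<lambda>i. if i < Suc n then K i n / of_real (sqrt (Re d)) else 0)"
    have bb: "b i * cnj (b j) = K i n * K n j / d" if "i < Suc n" "j < Suc n" for i j
    proof -
      have "of_real (sqrt (Re d)) * of_real (sqrt (Re d)) = (d :: complex)"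
        using d by (simp flip: of_real_mult)
      then show ?thesis using that herm[of n j] by (simp add: b_def)
    qed
    have last_col: "K i n = b i * cnj (b n)" "K n i = b n * cnj (b i)" if i: "i < Suc n" for i
    proof -
      have "K i n = K i n * K n n / d" "K n i = K n n * K n i / d"
        using positive_kernel_null_row[OF K _ i, of n] herm[OF i, of n] by (cases "d = 0"; simp add: d_def)+
      then show "K i n = b i * cnj (b n)" "K n i = b n * cnj (b i)"
        using bb[OF i, of n] bb[OF _ i, of n] by simp_all
    qed
    define L where "L = (\<lambda>i j. K i j - b i * cnj (b j))"
    have L0: "L i n = 0" "L n i = 0" if "i < Suc n" for i
      using last_col[OF that] by (simp_all add: L_def)
    have "positive_kernel n L"
      unfolding positive_kernel_def
    proof
      fix v :: "nat \<Rightarrow> complex"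
      \<comment> \<open>completing the square: this last coordinate makes the rank-one term vanish\<close>
      define x where "x = (if d = 0 then 0 else - (\<Sum>j<n. K n j * v j) / d)"
      define w where "w = (\<lambda>i. if i < n then v i else x)"
      have bw: "(\<Sum>j<Suc n. cnj (b j) * w j) = 0"
      proof (cases "d = 0")
        case True
        then show ?thesis by (simp add: b_def)
      next
        case False
        have "(\<Sum>j<Suc n. K n j * w j) = 0"
          using False by (simp add: w_def x_def d_def)
        moreover have "cnj (b j) * w j = K n j * w j / of_real (sqrt (Re d))" if "j < Suc n" for j
          using that herm[of n j] by (simp add: b_def)
        ultimately show ?thesis by (simp flip: sum_divide_distrib del: sum.lessThan_Suc)
      qed
      have "0 \<le> (\<Sum>i<Suc n. \<Sum>j<Suc n. K i j * w j * cnj (w i))"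
        using K unfolding positive_kernel_def by blast
      also have "\<dots> = (\<Sum>i<Suc n. \<Sum>j<Suc n. L i j * w j * cnj (w i))
          + (\<Sum>i<Suc n. b i * cnj (w i) * (\<Sum>j<Suc n. cnj (b j) * w j))"
        unfolding sum_distrib_left sum.distrib[symmetric]
        by (intro sum.cong refl) (simp add: L_def algebra_simps)
      also have "\<dots> = (\<Sum>i<Suc n. \<Sum>j<Suc n. L i j * w j * cnj (w i))"
        unfolding bw by simp
      also have "\<dots> = (\<Sum>i<n. \<Sum>j<n. L i j * v j * cnj (v i))"
        by (simp add: L0 w_def)
      finally show "0 \<le> (\<Sum>i<n. \<Sum>j<n. L i j * v j * cnj (v i))" .
    qed
    then obtain N a where a: "\<And>i j. i < n \<Longrightarrow> j < n \<Longrightarrow> L i j = (\<Sum>k<N::nat. a k i * cnj (a k j))"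
      using Suc.IH by blast
    define a' where "a' = (\<lambda>k i. if k = N then b i else if i < n then a k i else 0)"
    have "K i j = (\<Sum>k<Suc N. a' k i * cnj (a' k j))" if "i < Suc n" "j < Suc n" for i j
    proof -
      have "L i j = (\<Sum>k<N. a' k i * cnj (a' k j))"
        using that a[of i j] L0[of i] L0[of j] by (cases "i = n \<or> j = n") (auto simp: a'_def)
      then show ?thesis by (simp add: a'_def L_def diff_eq_eq)
    qed
    then show ?case by blast
  qed
  then show ?thesis using that by blast
qed

text \<open>A vector of the tensor product of the spaces of dimensions \<open>m\<close> and \<open>n\<close> is stored as an array \<open>X i j\<close>
  with \<open>i < m\<close> and \<open>j < n\<close>; then \<open>S \<otimes> 1\<close> and \<open>1 \<otimes> T\<close> act on the two indices separately.  The actions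
  vanish outside the index range, so that identities between vectors are equalities of functions.\<close>

definition left_action :: "nat \<Rightarrow> complex mat \<Rightarrow> (nat \<Rightarrow> nat \<Rightarrow> complex) \<Rightarrow> nat \<Rightarrow> nat \<Rightarrow> complex" where
  "left_action m S X = (\<lambda>i j. if i < m then \<Sum>k<m. S $$ (i, k) * X k j else 0)"

definition right_action :: "nat \<Rightarrow> complex mat \<Rightarrow> (nat \<Rightarrow> nat \<Rightarrow> complex) \<Rightarrow> nat \<Rightarrow> nat \<Rightarrow> complex" where
  "right_action n T X = (\<lambda>i j. if j < n then \<Sum>l<n. T $$ (j, l) * X i l else 0)"

lemma left_action_add: "left_action m S (X + Y) = left_action m S X + left_action m S Y"
  by (intro ext) (simp add: left_action_def algebra_simps sum.distrib)

lemma right_action_add: "right_action m S (X + Y) = right_action m S X + right_action m S Y"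
  by (intro ext) (simp add: right_action_def algebra_simps sum.distrib)

lemma left_right_action_commute:
  "left_action m S (right_action n T X) = right_action n T (left_action m S X)"
proof (intro ext)
  fix i j
  have "(\<Sum>k<m. S $$ (i, k) * (\<Sum>l<n. T $$ (j, l) * X k l))
      = (\<Sum>l<n. T $$ (j, l) * (\<Sum>k<m. S $$ (i, k) * X k l))"
    unfolding sum_distrib_left by (subst sum.swap) (simp add: ac_simps)
  then show "left_action m S (right_action n T X) i j = right_action n T (left_action m S X) i j"
    by (simp add: left_action_def right_action_def)
qed

lemma positive_operator_kernel:
  assumes "positive_operator n T"
  shows "positive_kernel n (\<lambda>i j. T $$ (i, j))"
  unfolding positive_kernel_def
proof
  fix v :: "nat \<Rightarrow> complex"
  have T: "T \<in> carrier_mat n n" using assms by (simp add: positive_operator_def)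
  have "(T *\<^sub>v vec n v) \<bullet>c vec n v = (\<Sum>i<n. \<Sum>j<n. T $$ (i, j) * v j * cnj (v i))"
    using T by (simp add: scalar_prod_def sum_distrib_right atLeast0LessThan)
  then show "0 \<le> (\<Sum>i<n. \<Sum>j<n. T $$ (i, j) * v j * cnj (v i))"
    using assms by (metis positive_operator_def vec_carrier)
qed

lemma sum_flattened_index:
  fixes f :: "nat \<Rightarrow> nat \<Rightarrow> 'c::comm_monoid_add"
  shows "(\<Sum>s<m * n. f (s div n) (s mod n)) = (\<Sum>i<m. \<Sum>j<n. f i j)"
proof -
  have "(\<Sum>i<m. \<Sum>j<n. f i j) = (\<Sum>i<m. \<Sum>s\<in>{i * n..<i * n + n}. f (s div n) (s mod n))"
  proof (rule sum.cong[OF refl])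
    fix i
    have "(\<Sum>s\<in>{i * n..<i * n + n}. f (s div n) (s mod n))
        = (\<Sum>j\<in>{0..<n}. f ((j + i * n) div n) ((j + i * n) mod n))"
      using sum.shift_bounds_nat_ivl[of "\<lambda>s. f (s div n) (s mod n)" 0 "i * n" n] by (simp add: add.commute)
    then show "(\<Sum>j<n. f i j) = (\<Sum>s\<in>{i * n..<i * n + n}. f (s div n) (s mod n))"
      by (simp add: atLeast0LessThan)
  qed
  then show ?thesis
    using sum.nat_group[of "\<lambda>s. f (s div n) (s mod n)" n m] by simp
qed

lemma kronecker_form:
  assumes S: "S \<in> carrier_mat m m" and T: "T \<in> carrier_mat n n" and \<xi>: "\<xi> \<in> carrier_vec (m * n)"
    and X: "X = (\<lambda>i j. if i < m \<and> j < n then \<xi> $ (i * n + j) else 0)"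
  shows "(kronecker S T *\<^sub>v \<xi>) \<bullet>c \<xi>
    = (\<Sum>i<m. \<Sum>j<n. left_action m S (right_action n T X) i j * cnj (X i j))"
proof -
  have \<xi>_eq: "\<xi> $ s = X (s div n) (s mod n)" if "s < m * n" for s
    using that unfolding X by (auto simp: less_mult_imp_div_less dest: gr_implies_not0 intro!: mod_less_divisor)
  have kr: "(kronecker S T *\<^sub>v \<xi>) $ r = left_action m S (right_action n T X) (r div n) (r mod n)"
    if r: "r < m * n" for r
  proof -
    have n: "0 < n" using r by (cases n) auto
    have "(kronecker S T *\<^sub>v \<xi>) $ r
        = (\<Sum>s<m * n. S $$ (r div n, s div n) * T $$ (r mod n, s mod n) * X (s div n) (s mod n))"
      using r S T \<xi> by (simp add: kronecker_def scalar_prod_def atLeast0LessThan \<xi>_eq)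
    also have "\<dots> = (\<Sum>k<m. \<Sum>l<n. S $$ (r div n, k) * T $$ (r mod n, l) * X k l)"
      by (rule sum_flattened_index)
    also have "\<dots> = left_action m S (right_action n T X) (r div n) (r mod n)"
      using r n by (simp add: left_action_def right_action_def less_mult_imp_div_less sum_distrib_left mult.assoc)
    finally show ?thesis .
  qed
  have "(kronecker S T *\<^sub>v \<xi>) \<bullet>c \<xi> = (\<Sum>r<m * n. (kronecker S T *\<^sub>v \<xi>) $ r * cnj (\<xi> $ r))"
    using \<xi> by (simp add: scalar_prod_def atLeast0LessThan)
  also have "\<dots> = (\<Sum>r<m * n. left_action m S (right_action n T X) (r div n) (r mod n) * cnj (X (r div n) (r mod n)))"
    by (intro sum.cong refl) (simp add: kr \<xi>_eq)
  also have "\<dots> = (\<Sum>i<m. \<Sum>j<n. left_action m S (right_action n T X) i j * cnj (X i j))"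
    by (rule sum_flattened_index)
  finally show ?thesis .
qed

text \<open>For Gram decompositions \<open>S = \<Sum>\<^sub>s a\<^sub>s a\<^sub>s\<^sup>*\<close> and \<open>T = \<Sum>\<^sub>t b\<^sub>t b\<^sub>t\<^sup>*\<close>, the quadratic form of \<open>S \<otimes> T\<close> at \<open>X\<close> is the sum
  of the squared moduli of the coefficients \<open>c s t\<close> of \<open>X\<close> along \<open>a\<^sub>s \<otimes> b\<^sub>t\<close>, and \<open>(S \<otimes> T) X\<close> is a linear
  combination of vectors with these same coefficients.  So the form is non-negative, and when it is
  zero the vector itself is zero.\<close>

lemma positive_tensor_form:
  fixes X :: "nat \<Rightarrow> nat \<Rightarrow> complex"
  assumes S: "positive_operator m S" and T: "positive_operator n T"
  defines "W \<equiv> left_action m S (right_action n T X)"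
  shows "0 \<le> (\<Sum>i<m. \<Sum>j<n. W i j * cnj (X i j))"
    and "(\<Sum>i<m. \<Sum>j<n. W i j * cnj (X i j)) = 0 \<Longrightarrow> W = 0"
proof -
  obtain N a where a: "\<And>i k. i < m \<Longrightarrow> k < m \<Longrightarrow> S $$ (i, k) = (\<Sum>s<N::nat. a s i * cnj (a s k))"
    using positive_kernel_gram[OF positive_operator_kernel[OF S]] by metis
  obtain M b where b: "\<And>j l. j < n \<Longrightarrow> l < n \<Longrightarrow> T $$ (j, l) = (\<Sum>t<M::nat. b t j * cnj (b t l))"
    using positive_kernel_gram[OF positive_operator_kernel[OF T]] by metis
  define c where "c = (\<lambda>s t. \<Sum>k<m. \<Sum>l<n. cnj (a s k) * cnj (b t l) * X k l)"
  have W: "W i j = (\<Sum>s<N. \<Sum>t<M. a s i * b t j * c s t)" if "i < m" "j < n" for i j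
  proof -
    have "W i j = (\<Sum>k<m. \<Sum>s<N. \<Sum>l<n. \<Sum>t<M. (a s i * b t j) * (cnj (a s k) * cnj (b t l) * X k l))"
      using that a b
      by (simp add: W_def left_action_def right_action_def sum_distrib_left sum_distrib_right sum_product ac_simps)
    also have "\<dots> = (\<Sum>s<N. \<Sum>k<m. \<Sum>l<n. \<Sum>t<M. (a s i * b t j) * (cnj (a s k) * cnj (b t l) * X k l))"
      by (rule sum.swap)
    also have "\<dots> = (\<Sum>s<N. \<Sum>k<m. \<Sum>t<M. \<Sum>l<n. (a s i * b t j) * (cnj (a s k) * cnj (b t l) * X k l))"
      by (intro sum.cong refl sum.swap)
    also have "\<dots> = (\<Sum>s<N. \<Sum>t<M. \<Sum>k<m. \<Sum>l<n. (a s i * b t j) * (cnj (a s k) * cnj (b t l) * X k l))"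
      by (intro sum.cong refl sum.swap)
    finally show ?thesis by (simp add: c_def sum_distrib_left)
  qed
  have cnj_c: "cnj (c s t) = (\<Sum>i<m. \<Sum>j<n. a s i * b t j * cnj (X i j))" for s t
    by (simp add: c_def)
  have "(\<Sum>i<m. \<Sum>j<n. W i j * cnj (X i j))
      = (\<Sum>i<m. \<Sum>j<n. \<Sum>s<N. \<Sum>t<M. c s t * (a s i * b t j * cnj (X i j)))"
    by (simp add: W sum_distrib_right sum_distrib_left ac_simps)
  also have "\<dots> = (\<Sum>i<m. \<Sum>s<N. \<Sum>j<n. \<Sum>t<M. c s t * (a s i * b t j * cnj (X i j)))"
    by (intro sum.cong refl sum.swap)
  also have "\<dots> = (\<Sum>s<N. \<Sum>i<m. \<Sum>j<n. \<Sum>t<M. c s t * (a s i * b t j * cnj (X i j)))"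
    by (rule sum.swap)
  also have "\<dots> = (\<Sum>s<N. \<Sum>i<m. \<Sum>t<M. \<Sum>j<n. c s t * (a s i * b t j * cnj (X i j)))"
    by (intro sum.cong refl sum.swap)
  also have "\<dots> = (\<Sum>s<N. \<Sum>t<M. \<Sum>i<m. \<Sum>j<n. c s t * (a s i * b t j * cnj (X i j)))"
    by (intro sum.cong refl sum.swap)
  also have "\<dots> = (\<Sum>s<N. \<Sum>t<M. c s t * cnj (c s t))"
    unfolding cnj_c by (simp add: sum_distrib_left)
  finally have eq: "(\<Sum>i<m. \<Sum>j<n. W i j * cnj (X i j)) = of_real (\<Sum>s<N. \<Sum>t<M. (cmod (c s t))\<^sup>2)"
    by (simp add: complex_norm_square del: of_real_power)
  show "0 \<le> (\<Sum>i<m. \<Sum>j<n. W i j * cnj (X i j))"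
    unfolding eq by (simp add: less_eq_complex_def sum_nonneg)
  show "W = 0" if "(\<Sum>i<m. \<Sum>j<n. W i j * cnj (X i j)) = 0"
  proof -
    have "(\<Sum>s<N. \<Sum>t<M. (cmod (c s t))\<^sup>2) = 0" using that unfolding eq of_real_eq_0_iff .
    then have c0: "c s t = 0" if "s < N" "t < M" for s t
      using that by (auto simp: sum_nonneg_eq_0_iff sum_nonneg)
    show "W = 0"
    proof (intro ext)
      fix i j
      show "W i j = 0 i j"
        using W[of i j] c0 by (cases "i < m \<and> j < n") (auto simp: W_def left_action_def right_action_def)
    qed
  qed
qed

section \<open>Quantum correlations as commuting measurements\<close>

text \<open>What the arguments below use of a quantum correlation: \<open>P x a\<close> and \<open>Q y b\<close> are the effects of Alice and
  Bob as commuting operators on the joint space, \<open>\<xi>\<close> is the shared state and \<open>\<omega>\<close> is the functional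
  \<open>v \<mapsto> Re \<langle>v, \<xi>\<rangle>\<close>.  The last assumption is the strong one: a vanishing probability is a vanishing vector.\<close>

locale commuting_measurements =
  fixes X :: "'x set" and Y :: "'y set" and A :: "'a set" and B :: "'b set"
    and P :: "'x \<Rightarrow> 'a \<Rightarrow> 'v::ab_group_add \<Rightarrow> 'v" and Q :: "'y \<Rightarrow> 'b \<Rightarrow> 'v \<Rightarrow> 'v"
    and \<xi> :: 'v and \<omega> :: "'v \<Rightarrow> real" and p :: "'x \<Rightarrow> 'y \<Rightarrow> 'a \<Rightarrow> 'b \<Rightarrow> real"
  assumes P_add: "P x a (v + w) = P x a v + P x a w"
    and Q_add: "Q y b (v + w) = Q y b v + Q y b w"
    and \<omega>_add: "\<omega> (v + w) = \<omega> v + \<omega> w"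
    and commute: "P x a (Q y b v) = Q y b (P x a v)"
    and P_total: "x \<in> X \<Longrightarrow> (\<Sum>a\<in>A. P x a \<xi>) = \<xi>"
    and Q_total: "y \<in> Y \<Longrightarrow> (\<Sum>b\<in>B. Q y b \<xi>) = \<xi>"
    and p_eq: "\<lbrakk>x \<in> X; y \<in> Y; a \<in> A; b \<in> B\<rbrakk> \<Longrightarrow> p x y a b = \<omega> (P x a (Q y b \<xi>))"
    and p_nonneg: "\<lbrakk>x \<in> X; y \<in> Y; a \<in> A; b \<in> B\<rbrakk> \<Longrightarrow> 0 \<le> p x y a b"
    and p_null: "\<lbrakk>x \<in> X; y \<in> Y; a \<in> A; b \<in> B; p x y a b = 0\<rbrakk> \<Longrightarrow> P x a (Q y b \<xi>) = 0"

lemma povm_left_total: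
  assumes "povm m A E" and "\<And>i j. m \<le> i \<Longrightarrow> X i j = 0"
  shows "(\<Sum>a\<in>A. left_action m (E a) X) = X"
proof (intro ext)
  fix i j
  have tot: "(\<Sum>a\<in>A. E a $$ (i, k)) = (if i = k then 1 else 0)" if "i < m" "k < m" for k
  proof -
    have "mat m m (\<lambda>(i, j). \<Sum>a\<in>A. E a $$ (i, j)) $$ (i, k) = 1\<^sub>m m $$ (i, k)"
      using assms(1) unfolding povm_def by simp
    then show ?thesis using that by simp
  qed
  have "(\<Sum>a\<in>A. left_action m (E a) X) i j = (\<Sum>a\<in>A. left_action m (E a) X i j)"
    by (induction A rule: infinite_finite_induct) auto
  also have "\<dots> = X i j"
  proof (cases "i < m")
    case True
    then have "(\<Sum>a\<in>A. left_action m (E a) X i j) = (\<Sum>k<m. (\<Sum>a\<in>A. E a $$ (i, k)) * X k j)"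
      unfolding left_action_def by (subst sum_distrib_right, subst sum.swap) simp
    also have "\<dots> = X i j" using True by (simp add: tot if_distrib[of "\<lambda>t. t * _"] cong: if_cong)
    finally show ?thesis .
  qed (simp add: left_action_def assms(2))
  finally show "(\<Sum>a\<in>A. left_action m (E a) X) i j = X i j" .
qed

lemma right_action_transpose:
  "right_action n T X = (\<lambda>i j. left_action n T (\<lambda>k l. X l k) j i)"
  by (simp add: left_action_def right_action_def)

lemma povm_right_total:
  assumes "povm n B F" and "\<And>i j. n \<le> j \<Longrightarrow> X i j = 0"
  shows "(\<Sum>b\<in>B. right_action n (F b) X) = X"
proof (intro ext)
  fix i j
  have "(\<Sum>b\<in>B. right_action n (F b) X) i j = (\<Sum>b\<in>B. left_action n (F b) (\<lambda>k l. X l k)) j i"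
    by (induction B rule: infinite_finite_induct) (auto simp: right_action_transpose)
  also have "\<dots> = X i j"
    by (subst povm_left_total[OF assms(1)]) (simp_all add: assms(2))
  finally show "(\<Sum>b\<in>B. right_action n (F b) X) i j = X i j" .
qed

lemma quantum_correlation_measurements:
  assumes "quantum_correlation X Y A B p"
  shows "\<exists>P Q (\<xi> :: nat \<Rightarrow> nat \<Rightarrow> complex) \<omega>. commuting_measurements X Y A B P Q \<xi> \<omega> p"
proof -
  obtain m n \<xi> E F where \<xi>: "\<xi> \<in> carrier_vec (m * n)"
    and E: "\<And>x. x \<in> X \<Longrightarrow> povm m A (E x)" and F: "\<And>y. y \<in> Y \<Longrightarrow> povm n B (F y)"
    and p: "\<And>x y a b. \<lbrakk>x \<in> X; y \<in> Y; a \<in> A; b \<in> B\<rbrakk> \<Longrightarrow>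
      complex_of_real (p x y a b) = (kronecker (E x a) (F y b) *\<^sub>v \<xi>) \<bullet>c \<xi>"
    using assms unfolding quantum_correlation_def by blast
  define Z where "Z = (\<lambda>i j. if i < m \<and> j < n then \<xi> $ (i * n + j) else 0)"
  define P where "P = (\<lambda>x a. left_action m (E x a))"
  define Q where "Q = (\<lambda>y b. right_action n (F y b))"
  define \<omega> where "\<omega> = (\<lambda>W. Re (\<Sum>i<m. \<Sum>j<n. W i j * cnj (Z i j)))"
  have pos: "positive_operator m (E x a)" if "x \<in> X" "a \<in> A" for x a
    using E[OF that(1)] that(2) by (simp add: povm_def)
  have pos': "positive_operator n (F y b)" if "y \<in> Y" "b \<in> B" for y b
    using F[OF that(1)] that(2) by (simp add: povm_def)
  have form: "(\<Sum>i<m. \<Sum>j<n. P x a (Q y b Z) i j * cnj (Z i j)) = complex_of_real (p x y a b)"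
    if "x \<in> X" "y \<in> Y" "a \<in> A" "b \<in> B" for x y a b
    using kronecker_form[OF _ _ \<xi> Z_def] pos[OF that(1,3)] pos'[OF that(2,4)] p[OF that]
    by (simp add: positive_operator_def P_def Q_def)
  have "commuting_measurements X Y A B P Q Z \<omega> p"
  proof
    show "P x a (v + w) = P x a v + P x a w" for x a v w
      by (simp add: P_def left_action_add)
    show "Q x a (v + w) = Q x a v + Q x a w" for x a v w
      by (simp add: Q_def right_action_add)
    show "\<omega> (v + w) = \<omega> v + \<omega> w" for v w
      by (simp add: \<omega>_def distrib_right sum.distrib)
    show "P x a (Q y b v) = Q y b (P x a v)" for x a y b v
      by (simp add: P_def Q_def left_right_action_commute)
    show "(\<Sum>a\<in>A. P x a Z) = Z" if "x \<in> X" for x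
      unfolding P_def by (rule povm_left_total[OF E[OF that]]) (simp add: Z_def)
    show "(\<Sum>b\<in>B. Q y b Z) = Z" if "y \<in> Y" for y
      unfolding Q_def by (rule povm_right_total[OF F[OF that]]) (simp add: Z_def)
    fix x y a b
    assume xyab: "x \<in> X" "y \<in> Y" "a \<in> A" "b \<in> B"
    show "p x y a b = \<omega> (P x a (Q y b Z))"
      by (simp only: \<omega>_def form[OF xyab] Re_complex_of_real)
    have "0 \<le> complex_of_real (p x y a b)"
      using positive_tensor_form(1)[OF pos[OF xyab(1,3)] pos'[OF xyab(2,4)], of Z] form[OF xyab]
      by (simp add: P_def Q_def)
    then show "0 \<le> p x y a b"
      by (simp add: less_eq_complex_def)
    show "P x a (Q y b Z) = 0" if "p x y a b = 0"
      using positive_tensor_form(2)[OF pos[OF xyab(1,3)] pos'[OF xyab(2,4)], of Z] form[OF xyab] that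
      by (simp add: P_def Q_def)
  qed
  then show ?thesis by blast
qed

context commuting_measurements
begin

lemma P_zero: "P x a 0 = 0"
  using P_add[of x a 0 0] by simp

lemma Q_zero: "Q y b 0 = 0"
  using Q_add[of y b 0 0] by simp

lemma \<omega>_zero: "\<omega> 0 = 0"
  using \<omega>_add[of 0 0] by simp

lemma P_sum: "P x a (sum f I) = (\<Sum>i\<in>I. P x a (f i))"
  by (induction I rule: infinite_finite_induct) (simp_all add: P_add P_zero)

lemma Q_sum: "Q y b (sum f I) = (\<Sum>i\<in>I. Q y b (f i))"
  by (induction I rule: infinite_finite_induct) (simp_all add: Q_add Q_zero)

lemma \<omega>_sum: "\<omega> (sum f I) = (\<Sum>i\<in>I. \<omega> (f i))"
  by (induction I rule: infinite_finite_induct) (simp_all add: \<omega>_add \<omega>_zero)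

lemma Bob_expansion: "y \<in> Y \<Longrightarrow> P x a \<xi> = (\<Sum>b\<in>B. P x a (Q y b \<xi>))"
  by (metis P_sum Q_total)

lemma Alice_expansion: "x \<in> X \<Longrightarrow> Q y b \<xi> = (\<Sum>a\<in>A. P x a (Q y b \<xi>))"
  unfolding commute by (metis Q_sum P_total)

text \<open>If Alice's outcome lies in \<open>R\<close> exactly when Bob's lies in \<open>C\<close>, then the two events act on \<open>\<xi>\<close> in the same
  way: both vectors are the sum of \<open>P x a (Q y b \<xi>)\<close> over \<open>a \<in> R\<close> and \<open>b \<in> C\<close>.\<close>

lemma perfectly_correlated_outcomes:
  assumes x: "x \<in> X" and y: "y \<in> Y" and fin: "finite A" "finite B" and R: "R \<subseteq> A" and C: "C \<subseteq> B"
    and RC: "\<And>a b. \<lbrakk>a \<in> R; b \<in> B - C\<rbrakk> \<Longrightarrow> P x a (Q y b \<xi>) = 0"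
    and CR: "\<And>a b. \<lbrakk>a \<in> A - R; b \<in> C\<rbrakk> \<Longrightarrow> P x a (Q y b \<xi>) = 0"
  shows "(\<Sum>a\<in>R. P x a \<xi>) = (\<Sum>b\<in>C. Q y b \<xi>)"
proof -
  have "(\<Sum>a\<in>R. P x a \<xi>) = (\<Sum>a\<in>R. \<Sum>b\<in>B. P x a (Q y b \<xi>))"
    by (simp only: Bob_expansion[OF y])
  also have "\<dots> = (\<Sum>a\<in>R. \<Sum>b\<in>C. P x a (Q y b \<xi>))"
    by (intro sum.cong refl sum.mono_neutral_right) (use fin C RC in auto)
  also have "\<dots> = (\<Sum>b\<in>C. \<Sum>a\<in>R. P x a (Q y b \<xi>))"
    by (rule sum.swap)
  also have "\<dots> = (\<Sum>b\<in>C. \<Sum>a\<in>A. P x a (Q y b \<xi>))"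
    by (intro sum.cong refl sum.mono_neutral_left) (use fin R CR in auto)
  also have "\<dots> = (\<Sum>b\<in>C. Q y b \<xi>)"
    by (simp only: Alice_expansion[OF x, symmetric])
  finally show ?thesis .
qed

end

section \<open>Winning answers in the hypergraph isomorphism game\<close>

text \<open>Only questions about the first hypergraph matter below; their winning answers come from the second
  one.\<close>

abbreviation vertex_question :: "'v \<Rightarrow> ('v, 'w) hyp_item" where "vertex_question v \<equiv> Inl (Inl v)"
abbreviation vertex_answer :: "'w \<Rightarrow> ('v, 'w) hyp_item" where "vertex_answer v \<equiv> Inl (Inr v)"
abbreviation edge_question :: "'v set \<Rightarrow> ('v, 'w) hyp_item" where "edge_question e \<equiv> Inr (Inl e)"
abbreviation edge_answer :: "'w set \<Rightarrow> ('v, 'w) hyp_item" where "edge_answer e \<equiv> Inr (Inr e)"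

lemma hyp_item_cases:
  obtains (qv) v where "z = vertex_question v" | (av) v where "z = vertex_answer v"
    | (qe) e where "z = edge_question e" | (ae) e where "z = edge_answer e"
  by (metis sum.exhaust)

lemma hypiso_rule_same_vertex:
  "hypiso_rule G1 G2 (vertex_question v) (vertex_question v) z (vertex_answer j) \<longleftrightarrow> z = vertex_answer j"
  "hypiso_rule G1 G2 (vertex_question v) (vertex_question v) (vertex_answer j) z \<longleftrightarrow> z = vertex_answer j"
  by (cases z rule: hyp_item_cases; simp add: hypergraph_relation_def)+

lemma hypiso_rule_incident:
  assumes "v \<in> e"
  shows "hypiso_rule G1 G2 (edge_question e) (vertex_question v) z (vertex_answer j)
      \<longleftrightarrow> (\<exists>f. z = edge_answer f \<and> j \<in> f)"
    and "hypiso_rule G1 G2 (edge_question e) (vertex_question v) (edge_answer f) z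
      \<longleftrightarrow> (\<exists>j. z = vertex_answer j \<and> j \<in> f)"
  using assms by (cases z rule: hyp_item_cases; simp)+

lemma simple_graph_edge:
  assumes "simple_graph G" "f \<in> hyperedges G" "a \<in> f" "b \<in> f" "a \<noteq> b"
  shows "f = {a, b}"
proof -
  have "card f = 2" using assms by (simp add: simple_graph_def)
  then show ?thesis using assms(3-5) by (auto simp: card_2_iff)
qed

lemma finite_simple_graph:
  assumes "simple_graph G"
  shows "finite (vertices G)" "finite (hyperedges G)"
proof -
  show V: "finite (vertices G)" using assms by (simp add: simple_graph_def)
  show "finite (hyperedges G)"
    by (rule finite_subset[of _ "Pow (vertices G)"]) (use assms V in \<open>auto simp: simple_graph_def\<close>)
qed

lemma finite_HypIso:
  assumes "simple_graph G1" "simple_graph G2"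
  shows "finite (answA (HypIso G1 G2))" "finite (answB (HypIso G1 G2))"
  using finite_simple_graph[OF assms(1)] finite_simple_graph[OF assms(2)]
  by (simp_all add: HypIso_def Let_def)

lemma hypiso_rule_incident_swapped:
  assumes "v \<in> e"
  shows "hypiso_rule G1 G2 (vertex_question v) (edge_question e) (vertex_answer j) z
      \<longleftrightarrow> (\<exists>f. z = edge_answer f \<and> j \<in> f)"
    and "hypiso_rule G1 G2 (vertex_question v) (edge_question e) z (edge_answer f)
      \<longleftrightarrow> (\<exists>j. z = vertex_answer j \<and> j \<in> f)"
  using assms by (cases z rule: hyp_item_cases; simp)+

lemma hypergraph_relation_simple_graph:
  assumes "simple_graph G"
  shows "hypergraph_relation G = graph_relation G"
proof (intro ext)
  fix v w
  have "(\<exists>e\<in>hyperedges G. v \<in> e \<and> w \<in> e) \<longleftrightarrow> {v, w} \<in> hyperedges G" if "v \<noteq> w"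
    using simple_graph_edge[OF assms, of _ v w] that by auto
  then show "hypergraph_relation G v w = graph_relation G v w"
    by (simp add: hypergraph_relation_def graph_relation_def)
qed

section \<open>Wigner's inequality for the hypergraph isomorphism game\<close>

text \<open>Suppose that the answers to the vertices \<open>v\<close> and \<open>w\<close> of an edge lie in disjoint sets \<open>A\<close> and \<open>B\<close>; since
  equal questions must receive equal answers, this is a condition on the diagonal probabilities alone.
  An edge answer contains the answers to both \<open>v\<close> and \<open>w\<close>, so only edges with one end in \<open>A\<close> and one in
  \<open>B\<close> occur, and the answer to \<open>v\<close> is the end in \<open>A\<close>.  By perfect correlation, first with Bob's vertex
  question and then with Alice's, the event that Alice answers \<open>a\<close> to \<open>v\<close> acts on the state as the event
  that she answers the edge question by an edge through \<open>a\<close>.\<close>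

lemma HypIso_edge_answer_refines_vertex_answer:
  fixes G1 :: "'v hgraph" and G2 :: "'w hgraph" and \<xi> :: "'h :: ab_group_add"
  defines "H \<equiv> HypIso G1 G2"
  assumes G: "simple_graph G1" "simple_graph G2"
    and meas: "commuting_measurements (questA H) (questB H) (answA H) (answB H) P Q \<xi> \<omega> p"
    and strategy: "perfect_q_strategy H p"
    and e: "{v, w} \<in> hyperedges G1"
    and disjoint: "A \<inter> B = {}"
    and v_dead: "\<forall>j\<in>vertices G2 - A. p (vertex_question v) (vertex_question v) (vertex_answer j) (vertex_answer j) = 0"
    and w_dead: "\<forall>j\<in>vertices G2 - B. p (vertex_question w) (vertex_question w) (vertex_answer j) (vertex_answer j) = 0"
  shows "\<And>j. \<lbrakk>j \<in> vertices G2; j \<notin> B\<rbrakk> \<Longrightarrow> Q (vertex_question w) (vertex_answer j) \<xi> = 0"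
    and "\<And>f. \<lbrakk>f \<in> hyperedges G2; f \<inter> B = {}\<rbrakk> \<Longrightarrow> P (edge_question {v, w}) (edge_answer f) \<xi> = 0"
    and "\<And>a. \<lbrakk>a \<in> vertices G2; a \<in> A\<rbrakk> \<Longrightarrow> P (vertex_question v) (vertex_answer a) \<xi>
      = (\<Sum>f | f \<in> hyperedges G2 \<and> a \<in> f. P (edge_question {v, w}) (edge_answer f) \<xi>)"
proof -
  interpret commuting_measurements "questA H" "questB H" "answA H" "answB H" P Q \<xi> \<omega> p
    by (rule meas)
  have rule: "rule H = hypiso_rule G1 G2" by (simp add: H_def HypIso_def Let_def)
  have in_graph: "j \<in> vertices G2" if "j \<in> f" "f \<in> hyperedges G2" for j f
    using G(2) that by (auto simp: simple_graph_def)
  have v: "v \<in> vertices G1" and w: "w \<in> vertices G1"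
    using G(1) e by (auto simp: simple_graph_def)
  have questions [simp]: "vertex_question u \<in> questA H \<longleftrightarrow> u \<in> vertices G1" "vertex_question u \<in> questB H \<longleftrightarrow> u \<in> vertices G1"
      "edge_question {v, w} \<in> questA H" for u
    using e by (auto simp: H_def HypIso_def Let_def)
  have answers [simp]: "vertex_answer j \<in> answA H \<longleftrightarrow> j \<in> vertices G2" "vertex_answer j \<in> answB H \<longleftrightarrow> j \<in> vertices G2"
      "edge_answer f \<in> answA H \<longleftrightarrow> f \<in> hyperedges G2" for j f
    by (auto simp: H_def HypIso_def Let_def)
  have fin: "finite (answA H)" "finite (answB H)"
    using finite_HypIso[OF G] by (simp_all add: H_def)
  have perfect: "p x y a b = 0"
    if "x \<in> questA H" "y \<in> questB H" "a \<in> answA H" "b \<in> answB H" "\<not> rule H x y a b" for x y a b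
    using strategy that unfolding perfect_q_strategy_def by blast
  have null: "P x a (Q y b \<xi>) = 0"
    if "x \<in> questA H" "y \<in> questB H" "a \<in> answA H" "b \<in> answB H" "\<not> hypiso_rule G1 G2 x y a b" for x y a b
    using that perfect p_null rule by metis
  have Q_dead: "Q (vertex_question u) (vertex_answer j) \<xi> = 0"
    if uj: "u \<in> vertices G1" "j \<in> vertices G2"
      "p (vertex_question u) (vertex_question u) (vertex_answer j) (vertex_answer j) = 0" for u j
  proof -
    have "P (vertex_question u) z (Q (vertex_question u) (vertex_answer j) \<xi>) = 0" if z: "z \<in> answA H" for z
    proof (cases "z = vertex_answer j")
      case True
      show ?thesis unfolding True by (rule p_null) (use uj in simp_all)
    next
      case False
      show ?thesis by (rule null) (use uj z False in \<open>simp_all add: hypiso_rule_same_vertex\<close>)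
    qed
    then show ?thesis
      using uj(1) by (subst Alice_expansion[of "vertex_question u"]) simp_all
  qed
  show w_null: "Q (vertex_question w) (vertex_answer j) \<xi> = 0" if "j \<in> vertices G2" "j \<notin> B" for j
    using Q_dead w w_dead that by blast
  show f_null: "P (edge_question {v, w}) (edge_answer f) \<xi> = 0" if f: "f \<in> hyperedges G2" "f \<inter> B = {}" for f
  proof -
    have "P (edge_question {v, w}) (edge_answer f) (Q (vertex_question w) z \<xi>) = 0" if z: "z \<in> answB H" for z
    proof (cases "hypiso_rule G1 G2 (edge_question {v, w}) (vertex_question w) (edge_answer f) z")
      case True
      then obtain j where "z = vertex_answer j" "j \<in> f" by (auto simp: hypiso_rule_incident)
      then have "Q (vertex_question w) z \<xi> = 0" using w_null[of j] f in_graph[of j f] by blast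
      then show ?thesis by (simp add: P_zero)
    qed (rule null; use w z f in simp)
    then show ?thesis
      using w by (subst Bob_expansion[of "vertex_question w"]) simp_all
  qed
  fix a assume a: "a \<in> vertices G2" "a \<in> A"
  have "(\<Sum>z\<in>{vertex_answer a}. P (vertex_question v) z \<xi>) = (\<Sum>z\<in>{vertex_answer a}. Q (vertex_question v) z \<xi>)"
  proof (rule perfectly_correlated_outcomes[OF _ _ fin])
    show "P (vertex_question v) y (Q (vertex_question v) z \<xi>) = 0"
      if "y \<in> {vertex_answer a}" "z \<in> answB H - {vertex_answer a}" for y z
      by (rule null) (use that a v in \<open>simp_all add: hypiso_rule_same_vertex\<close>)
    show "P (vertex_question v) y (Q (vertex_question v) z \<xi>) = 0"
      if "y \<in> answA H - {vertex_answer a}" "z \<in> {vertex_answer a}" for y z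
      by (rule null) (use that a v in \<open>simp_all add: hypiso_rule_same_vertex\<close>)
  qed (use a v in simp_all)
  moreover have "(\<Sum>z\<in>edge_answer ` {f \<in> hyperedges G2. a \<in> f}. P (edge_question {v, w}) z \<xi>)
      = (\<Sum>z\<in>{vertex_answer a}. Q (vertex_question v) z \<xi>)"
  proof (rule perfectly_correlated_outcomes[OF _ _ fin])
    fix y z :: "('v, 'w) hyp_item"
    assume "y \<in> edge_answer ` {f \<in> hyperedges G2. a \<in> f}" and z: "z \<in> answB H - {vertex_answer a}"
    then obtain f where f: "y = edge_answer f" "f \<in> hyperedges G2" "a \<in> f" by blast
    show "P (edge_question {v, w}) y (Q (vertex_question v) z \<xi>) = 0"
    proof (cases "hypiso_rule G1 G2 (edge_question {v, w}) (vertex_question v) y z")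
      case True
      then obtain k where k: "z = vertex_answer k" "k \<in> f" by (auto simp: hypiso_rule_incident f)
      show ?thesis
      proof (cases "k \<in> A")
        case True
        have "f = {a, k}" using simple_graph_edge[OF G(2) f(2,3) k(2)] z k(1) by auto
        then have "f \<inter> B = {}" using a(2) True disjoint by blast
        then have "P (edge_question {v, w}) y \<xi> = 0" using f_null[OF f(2)] f(1) by simp
        then show ?thesis by (simp add: commute Q_zero)
      next
        case False
        then have "Q (vertex_question v) z \<xi> = 0"
          using Q_dead[OF v in_graph[OF k(2) f(2)]] v_dead in_graph[OF k(2) f(2)] k(1) by simp
        then show ?thesis by (simp add: P_zero)
      qed
    qed (rule null; use z f v in simp)
  next
    fix y z :: "('v, 'w) hyp_item"
    assume y: "y \<in> answA H - edge_answer ` {f \<in> hyperedges G2. a \<in> f}" and z: "z \<in> {vertex_answer a}"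
    have "\<not> hypiso_rule G1 G2 (edge_question {v, w}) (vertex_question v) y (vertex_answer a)"
    proof
      assume "hypiso_rule G1 G2 (edge_question {v, w}) (vertex_question v) y (vertex_answer a)"
      then obtain f where f: "y = edge_answer f" "a \<in> f"
        using hypiso_rule_incident(1)[of v "{v, w}" G1 G2 y a] by blast
      then have "f \<in> hyperedges G2" using y by simp
      then show False using f y by blast
    qed
    then have "P (edge_question {v, w}) y (Q (vertex_question v) (vertex_answer a) \<xi>) = 0"
      using y a v by (intro null) simp_all
    then show "P (edge_question {v, w}) y (Q (vertex_question v) z \<xi>) = 0"
      using z by simp
  next
    show "edge_answer ` {f \<in> hyperedges G2. a \<in> f} \<subseteq> answA H" by auto
  qed (use a v in simp_all)
  moreover have "(\<Sum>z\<in>edge_answer ` {f \<in> hyperedges G2. a \<in> f}. P (edge_question {v, w}) z \<xi>)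
      = (\<Sum>f\<in>{f \<in> hyperedges G2. a \<in> f}. P (edge_question {v, w}) (edge_answer f) \<xi>)"
    by (subst sum.reindex) (simp_all add: inj_on_def)
  ultimately show "P (vertex_question v) (vertex_answer a) \<xi>
      = (\<Sum>f | f \<in> hyperedges G2 \<and> a \<in> f. P (edge_question {v, w}) (edge_answer f) \<xi>)"
    by (simp only: sum.insert sum.empty finite.emptyI empty_iff add_0_right if_False not_False_eq_True)
qed

text \<open>Write \<open>x\<close> and \<open>z\<close> for the answers to \<open>v\<close> and to \<open>w\<close>, where \<open>z \<in> {b, b'}\<close>.  If the answers to \<open>v\<close>, \<open>w\<close>, \<open>y\<close>
  have a joint distribution, then the event that \<open>v\<close> is answered by \<open>a\<close> and \<open>y\<close> by \<open>c\<close> is covered by the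
  event \<open>x = a, z = b'\<close> and the event that \<open>z = b\<close> and \<open>y\<close> is answered by \<open>c\<close>.  The joint distribution is
  that of Alice's answer to the edge \<open>{v, w}\<close> and Bob's answer to \<open>y\<close>.\<close>

lemma HypIso_Wigner_inequality:
  fixes G1 :: "'v hgraph" and G2 :: "'w hgraph"
  assumes G: "simple_graph G1" "simple_graph G2"
    and strategy: "perfect_q_strategy (HypIso G1 G2) p"
    and e: "{v, w} \<in> hyperedges G1" and y: "y \<in> vertices G1"
    and disjoint: "A \<inter> {b, b'} = {}"
    and v_dead: "\<forall>j\<in>vertices G2 - A. p (vertex_question v) (vertex_question v) (vertex_answer j) (vertex_answer j) = 0"
    and w_dead: "\<forall>j\<in>vertices G2 - {b, b'}. p (vertex_question w) (vertex_question w) (vertex_answer j) (vertex_answer j) = 0"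
    and a: "a \<in> A" and abc: "a \<in> vertices G2" "b \<in> vertices G2" "b' \<in> vertices G2" "c \<in> vertices G2"
  shows "p (vertex_question v) (vertex_question y) (vertex_answer a) (vertex_answer c)
    \<le> p (vertex_question v) (vertex_question w) (vertex_answer a) (vertex_answer b')
      + p (vertex_question w) (vertex_question y) (vertex_answer b) (vertex_answer c)"
proof -
  define H where "H = HypIso G1 G2"
  have "quantum_correlation (questA H) (questB H) (answA H) (answB H) p"
    using strategy by (simp add: perfect_q_strategy_def H_def)
  from quantum_correlation_measurements[OF this]
  obtain P Q and \<xi> :: "nat \<Rightarrow> nat \<Rightarrow> complex" and \<omega>
    where meas: "commuting_measurements (questA H) (questB H) (answA H) (answB H) P Q \<xi> \<omega> p"
    by (elim exE)
  interpret commuting_measurements "questA H" "questB H" "answA H" "answB H" P Q \<xi> \<omega> p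
    by (rule meas)
  have perfect: "p x y a b = 0"
    if "x \<in> questA H" "y \<in> questB H" "a \<in> answA H" "b \<in> answB H" "\<not> rule H x y a b" for x y a b
    using strategy that unfolding perfect_q_strategy_def H_def by blast
  have rule: "rule H = hypiso_rule G1 G2" by (simp add: H_def HypIso_def Let_def)
  have v: "v \<in> vertices G1" and w: "w \<in> vertices G1"
    using G(1) e by (auto simp: simple_graph_def)
  have questions [simp]: "vertex_question u \<in> questA H \<longleftrightarrow> u \<in> vertices G1" "vertex_question u \<in> questB H \<longleftrightarrow> u \<in> vertices G1"
      "edge_question {v, w} \<in> questA H" for u
    using e by (auto simp: H_def HypIso_def Let_def)
  have answers [simp]: "vertex_answer j \<in> answA H \<longleftrightarrow> j \<in> vertices G2" "vertex_answer j \<in> answB H \<longleftrightarrow> j \<in> vertices G2"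
      "edge_answer f \<in> answA H \<longleftrightarrow> f \<in> hyperedges G2" for j f
    by (auto simp: H_def HypIso_def Let_def)
  have fin: "finite (hyperedges G2)" by (rule finite_simple_graph[OF G(2)])
  have strategy': "perfect_q_strategy H p" using strategy by (simp add: H_def)
  have wv: "{w, v} = {v, w}" by auto
  have e': "{w, v} \<in> hyperedges G1" using e wv by simp
  have disjoint': "{b, b'} \<inter> A = {}" using disjoint by blast
  note at_v = HypIso_edge_answer_refines_vertex_answer[OF G, folded H_def, OF meas strategy' e disjoint v_dead w_dead]
  note at_w = HypIso_edge_answer_refines_vertex_answer[OF G, folded H_def, OF meas strategy' e' disjoint' w_dead v_dead, unfolded wv]
  \<comment> \<open>\<open>D u\<close>: the edge answers through \<open>u\<close>; \<open>q f\<close>: probability of \<open>f\<close> and of \<open>c\<close> as Bob's answer to \<open>y\<close>;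
     \<open>r f\<close>: probability of \<open>f\<close> and of \<open>b'\<close> as Bob's answer to \<open>w\<close>\<close>
  define D where "D = (\<lambda>u. {f \<in> hyperedges G2. u \<in> f})"
  define q where "q = (\<lambda>f. \<omega> (P (edge_question {v, w}) (edge_answer f) (Q (vertex_question y) (vertex_answer c) \<xi>)))"
  define r where "r = (\<lambda>f. \<omega> (P (edge_question {v, w}) (edge_answer f) (Q (vertex_question w) (vertex_answer b') \<xi>)))"
  have q_p: "q f = p (edge_question {v, w}) (vertex_question y) (edge_answer f) (vertex_answer c)"
    if "f \<in> hyperedges G2" for f
    using that y abc by (simp add: q_def p_eq)
  have q_nonneg: "0 \<le> q f" if "f \<in> hyperedges G2" for f
    using q_p[OF that] p_nonneg that y abc by simp
  have r_nonneg: "0 \<le> r f" if "f \<in> hyperedges G2" for f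
    using p_nonneg[of "edge_question {v, w}" "vertex_question w" "edge_answer f" "vertex_answer b'"]
      p_eq[of "edge_question {v, w}" "vertex_question w" "edge_answer f" "vertex_answer b'"] that w abc
    by (simp add: r_def)
  have finD: "finite (D u)" for u using fin by (simp add: D_def)
  have va: "P (vertex_question v) (vertex_answer a) \<xi> = (\<Sum>f\<in>D a. P (edge_question {v, w}) (edge_answer f) \<xi>)"
    using at_v(3)[of a] a abc(1) by (simp add: D_def)
  have wb: "P (vertex_question w) (vertex_answer b) \<xi> = (\<Sum>f\<in>D b. P (edge_question {v, w}) (edge_answer f) \<xi>)"
    using at_w(3)[of b] abc(2) by (simp add: D_def)
  have p1: "p (vertex_question v) (vertex_question y) (vertex_answer a) (vertex_answer c) = (\<Sum>f\<in>D a. q f)"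
    using v y abc by (simp add: p_eq commute va Q_sum \<omega>_sum q_def)
  have p2: "p (vertex_question w) (vertex_question y) (vertex_answer b) (vertex_answer c) = (\<Sum>f\<in>D b. q f)"
    using w y abc by (simp add: p_eq commute wb Q_sum \<omega>_sum q_def)
  have p3: "p (vertex_question v) (vertex_question w) (vertex_answer a) (vertex_answer b') = (\<Sum>f\<in>D a. r f)"
    using v w abc by (simp add: p_eq commute va Q_sum \<omega>_sum r_def)
  \<comment> \<open>an edge answer through \<open>a\<close> and \<open>b'\<close> already forces the answer \<open>b'\<close> to \<open>w\<close>, so \<open>r f\<close> is its full marginal\<close>
  have q_le_r: "q f \<le> r f" if f: "f \<in> D a \<inter> D b'" for f
  proof -
    let ?P = "P (edge_question {v, w}) (edge_answer f)"
    have fE: "f \<in> hyperedges G2" using f by (simp add: D_def)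
    have "?P (Q (vertex_question w) z \<xi>) = 0" if z: "z \<in> answB H" "z \<noteq> vertex_answer b'" for z
    proof (cases "hypiso_rule G1 G2 (edge_question {v, w}) (vertex_question w) (edge_answer f) z")
      case True
      then obtain k where k: "z = vertex_answer k" "k \<in> f" 
        using hypiso_rule_incident(2)[of w "{v, w}" G1 G2 f z] by blast
      have "f = {a, b'}" using simple_graph_edge[OF G(2) fE, of a b'] f a disjoint by (auto simp: D_def)
      then have "k = a" using k z by auto
      then have "Q (vertex_question w) z \<xi> = 0" using at_v(1)[of a] abc(1) a disjoint k(1) by blast
      then show ?thesis by (simp add: P_zero)
    next
      case False
      then show ?thesis using z w fE by (intro p_null perfect) (simp_all add: rule)
    qed
    then have "?P \<xi> = ?P (Q (vertex_question w) (vertex_answer b') \<xi>)"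
      using w abc(3) finite_HypIso(2)[OF G, folded H_def]
      by (subst Bob_expansion[of "vertex_question w"]) (simp_all add: sum.remove[of "answB H" "vertex_answer b'"])
    then have "r f = (\<Sum>z\<in>answB H. \<omega> (?P (Q (vertex_question y) z \<xi>)))"
      using y by (subst (asm) Bob_expansion[of "vertex_question y"]) (simp_all add: r_def \<omega>_sum flip: \<omega>_sum)
    also have "\<dots> = (\<Sum>z\<in>answB H. p (edge_question {v, w}) (vertex_question y) (edge_answer f) z)"
      using y fE by (simp add: p_eq)
    also have "\<dots> \<ge> p (edge_question {v, w}) (vertex_question y) (edge_answer f) (vertex_answer c)"
      using y fE abc(4) finite_HypIso(2)[OF G, folded H_def] by (intro member_le_sum) (simp_all add: p_nonneg)
    finally show ?thesis using q_p[OF fE] by simp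
  qed
  have D_E: "D u \<subseteq> hyperedges G2" for u by (auto simp: D_def)
  have "(\<Sum>f\<in>D a. q f) = (\<Sum>f\<in>(D a \<inter> D b) \<union> (D a \<inter> D b'). q f)"
  proof (rule sum.mono_neutral_right)
    show "\<forall>f\<in>D a - ((D a \<inter> D b) \<union> (D a \<inter> D b')). q f = 0"
    proof
      fix f assume f: "f \<in> D a - ((D a \<inter> D b) \<union> (D a \<inter> D b'))"
      then have "P (edge_question {v, w}) (edge_answer f) \<xi> = 0"
        by (intro at_v(2)) (auto simp: D_def)
      then show "q f = 0" by (simp add: q_def commute Q_zero \<omega>_zero)
    qed
  qed (use finD in auto)
  also have "\<dots> \<le> (\<Sum>f\<in>D a \<inter> D b. q f) + (\<Sum>f\<in>D a \<inter> D b'. q f)"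
    using sum.union_inter[of "D a \<inter> D b" "D a \<inter> D b'" q] finD sum_nonneg[of "(D a \<inter> D b) \<inter> (D a \<inter> D b')" q] q_nonneg D_E
    by fastforce
  also have "\<dots> \<le> (\<Sum>f\<in>D b. q f) + (\<Sum>f\<in>D a \<inter> D b'. r f)"
    using finD q_nonneg D_E q_le_r by (intro add_mono sum_mono2 sum_mono) blast+
  also have "(\<Sum>f\<in>D a \<inter> D b'. r f) \<le> (\<Sum>f\<in>D a. r f)"
    using finD r_nonneg D_E by (intro sum_mono2) blast+
  finally show ?thesis using p1 p2 p3 by simp
qed

section \<open>A nonlocal strategy on the complete graph with six vertices\<close>

definition complete6 :: "nat hgraph" where
  "complete6 = \<lparr>vertices = {..<6}, hyperedges = {e. e \<subseteq> {..<6} \<and> card e = 2}\<rparr>"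

lemma vertices_complete6 [simp]: "vertices complete6 = {..<6}"
  by (simp add: complete6_def)

lemma edge_complete6: "v < 6 \<Longrightarrow> w < 6 \<Longrightarrow> v \<noteq> w \<Longrightarrow> {v, w} \<in> hyperedges complete6"
  by (simp add: complete6_def)

lemma simple_graph_complete6: "simple_graph complete6"
  by (auto simp: simple_graph_def complete6_def)

lemma hypergraph_complete6: "hypergraph complete6"
proof -
  have "v \<in> \<Union> (hyperedges complete6)" if "v < 6" for v
    using edge_complete6[of v 0] edge_complete6[of v 1] that by (cases "v = 0") auto
  moreover have "hyperedges complete6 \<noteq> {}" using edge_complete6[of 0 1] by auto
  ultimately show ?thesis using simple_graph_complete6 by (auto simp: hypergraph_def simple_graph_def)
qed

lemma iso_rule_complete6:
  assumes "v < 6" "w < 6" "v' < 6" "w' < 6"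
  shows "graph_relation complete6 v w = graph_relation complete6 v' w' \<longleftrightarrow> (v = w \<longleftrightarrow> v' = w')"
  using assms edge_complete6 by (auto simp: graph_relation_def)

text \<open>Successive lines, spanned by \<open>(2, 1)\<close>, \<open>(1, 0)\<close> and \<open>(2, -1)\<close>, form the angle \<open>\<theta>\<close> with
  \<open>cos \<theta> = 2 / sqrt 5\<close>.  A line and the orthogonal complement of another one at the angle \<open>\<phi>\<close> will
  have the joint probability \<open>sin\<^sup>2 \<phi> / 2\<close>, so Wigner's inequality fails if
  \<open>sin\<^sup>2 (2\<theta>) > 2 sin\<^sup>2 \<theta>\<close>, that is, \<open>cos\<^sup>2 \<theta> > 1 / 2\<close>.  This choice keeps all projections rational.\<close>

definition axis :: "nat \<Rightarrow> real \<times> real" where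
  "axis k = (if k = 0 then (2, 1) else if k = 1 then (1, 0) else (2, -1))"

definition direction :: "nat \<Rightarrow> bool \<Rightarrow> nat \<Rightarrow> real" where
  "direction k t i = (if t then (if i = 0 then fst (axis k) else snd (axis k))
     else (if i = 0 then - snd (axis k) else fst (axis k)))"

text \<open>The block diagonal magic unitary: the blocks are the pairs of vertices with the same half, and the
  block of \<open>k\<close> has the projection onto the \<open>k\<close>-th line on its diagonal and the complementary projection
  elsewhere.\<close>

definition magic_entry :: "nat \<Rightarrow> nat \<Rightarrow> nat \<Rightarrow> nat \<Rightarrow> real" where
  "magic_entry v w i j = (if v div 2 = w div 2 then
     direction (v div 2) (v = w) i * direction (v div 2) (v = w) j / ((fst (axis (v div 2)))\<^sup>2 + (snd (axis (v div 2)))\<^sup>2) else 0)"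

lemma lessThan_6: "{..<6} = {0, 1, 2, 3, 4, 5 :: nat}"
  by auto

lemma lessThan_2: "{..<2} = {0, 1 :: nat}"
  by auto

lemma less_6_cases:
  assumes "(v::nat) < 6"
  shows "v = 0 \<or> v = 1 \<or> v = 2 \<or> v = 3 \<or> v = 4 \<or> v = 5"
proof -
  have "v \<in> {..<6}" using assms by simp
  then show ?thesis unfolding lessThan_6 by simp
qed

lemma same_half_cases:
  fixes v :: nat
  assumes "v div 2 = w div 2" "v div 2 = w' div 2" "w \<noteq> w'"
  shows "v = w \<or> v = w'"
proof -
  have "x = 2 * (x div 2) \<or> x = Suc (2 * (x div 2))" for x :: nat
    by (cases "even x") (auto elim!: evenE oddE)
  from this[of v] this[of w] this[of w'] show ?thesis using assms by auto
qed

lemma magic_entry_sum: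
  assumes "v < 6" "i < 2" "j < 2"
  shows "(\<Sum>w<6. magic_entry v w i j) = (if i = j then 1 else 0)"
    and "(\<Sum>w<6. magic_entry w v i j) = (if i = j then 1 else 0)"
  using less_6_cases[OF assms(1)] less_2_cases[OF assms(2)] less_2_cases[OF assms(3)]
  by (elim disjE; simp add: lessThan_6 magic_entry_def direction_def axis_def)+

text \<open>Two entries of a row or of a column are complementary projections if both lie in a block; otherwise
  one of them is zero.\<close>

lemma magic_orthogonal:
  assumes "w \<noteq> w'"
  shows "(\<Sum>i<2. \<Sum>j<2. magic_entry v w i j * magic_entry v w' i j) = 0"
    and "(\<Sum>i<2. \<Sum>j<2. magic_entry w v i j * magic_entry w' v i j) = 0"
proof -
  define k where "k = v div 2"
  define c where "c = (fst (axis k))\<^sup>2 + (snd (axis k))\<^sup>2"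
  have entry: "magic_entry x y i j = direction k (x = y) i * direction k (x = y) j / c"
    if "x div 2 = k" "y div 2 = k" for x y i j
    using that by (simp add: magic_entry_def c_def)
  have orth: "(\<Sum>i<2. \<Sum>j<2. (direction k x i * direction k x j / c) * (direction k y i * direction k y j / c)) = 0"
    if "x \<noteq> y" for x y
  proof -
    have "(\<Sum>i<2. \<Sum>j<2. (direction k x i * direction k x j / c) * (direction k y i * direction k y j / c))
        = (\<Sum>i<2. direction k x i * direction k y i) * (\<Sum>j<2. direction k x j * direction k y j) / (c * c)"
      unfolding sum_product sum_divide_distrib by (intro sum.cong refl) (simp add: ac_simps)
    moreover have "(\<Sum>i<2. direction k x i * direction k y i) = 0"
      using that by (cases x; cases y) (simp_all add: lessThan_2 direction_def)
    ultimately show ?thesis by simp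
  qed
  have one: "v = w \<or> v = w'" if "v div 2 = w div 2" "v div 2 = w' div 2"
    using same_half_cases[OF that] assms by blast
  show "(\<Sum>i<2. \<Sum>j<2. magic_entry v w i j * magic_entry v w' i j) = 0"
  proof (cases "v div 2 = w div 2 \<and> v div 2 = w' div 2")
    case True
    then have "(v = w) \<noteq> (v = w')" using one assms by blast
    moreover have kk: "v div 2 = k" "w div 2 = k" "w' div 2 = k" using True by (simp_all add: k_def)
    ultimately show ?thesis using orth[of "v = w" "v = w'"] by (simp add: entry[OF kk(1,2)] entry[OF kk(1,3)])
  qed (auto simp: magic_entry_def intro!: sum.neutral)
  show "(\<Sum>i<2. \<Sum>j<2. magic_entry w v i j * magic_entry w' v i j) = 0"
  proof (cases "v div 2 = w div 2 \<and> v div 2 = w' div 2")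
    case True
    then have "(w = v) \<noteq> (w' = v)" using one assms by blast
    moreover have kk: "v div 2 = k" "w div 2 = k" "w' div 2 = k" using True by (simp_all add: k_def)
    ultimately show ?thesis using orth[of "w = v" "w' = v"] by (simp add: entry[OF kk(2,1)] entry[OF kk(3,1)])
  qed (auto simp: magic_entry_def intro!: sum.neutral)
qed

definition block_effect :: "nat + nat \<Rightarrow> nat + nat \<Rightarrow> nat \<Rightarrow> nat \<Rightarrow> real" where
  "block_effect x a i j = (case sides x a of None \<Rightarrow> 0 | Some (v, w) \<Rightarrow> magic_entry v w i j)"

text \<open>For real symmetric effects \<open>S\<close>, \<open>T\<close> on the plane, the maximally entangled state yields the probability
  \<open>tr (S T) / 2\<close>.\<close>

definition block_strategy :: "nat + nat \<Rightarrow> nat + nat \<Rightarrow> nat + nat \<Rightarrow> nat + nat \<Rightarrow> real" where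
  "block_strategy x y a b = (\<Sum>i<2. \<Sum>j<2. block_effect x a i j * block_effect y b i j) / 2"

definition effect_matrix :: "nat + nat \<Rightarrow> nat + nat \<Rightarrow> complex mat" where
  "effect_matrix x a = mat 2 2 (\<lambda>(i, j). complex_of_real (block_effect x a i j))"

lemma positive_operator_rank_one:
  fixes u :: "nat \<Rightarrow> real"
  assumes "0 \<le> c"
  shows "positive_operator n (mat n n (\<lambda>(i, j). complex_of_real (c * u i * u j)))"
  unfolding positive_operator_def
proof (intro conjI ballI)
  fix v :: "complex vec" assume v: "v \<in> carrier_vec n"
  define s where "s = (\<Sum>j<n. complex_of_real (u j) * v $ j)"
  have "(mat n n (\<lambda>(i, j). complex_of_real (c * u i * u j)) *\<^sub>v v) \<bullet>c v
      = (\<Sum>i<n. (\<Sum>j<n. of_real (c * u i * u j) * v $ j) * cnj (v $ i))"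
    using v by (simp add: scalar_prod_def atLeast0LessThan)
  also have "\<dots> = of_real c * (s * cnj s)"
    by (simp add: s_def sum_product sum_distrib_left sum_distrib_right ac_simps)
  also have "\<dots> = of_real (c * (cmod s)\<^sup>2)"
    by (simp add: complex_norm_square del: of_real_power)
  finally show "0 \<le> (mat n n (\<lambda>(i, j). complex_of_real (c * u i * u j)) *\<^sub>v v) \<bullet>c v"
    using assms by (simp add: less_eq_complex_def)
qed simp

lemma positive_effect_matrix: "positive_operator 2 (effect_matrix x a)"
proof -
  have "\<exists>c u. 0 \<le> c \<and> block_effect x a = (\<lambda>i j. c * u i * u j)"
  proof (cases "sides x a")
    case None
    then show ?thesis by (intro exI[of _ 0]) (simp add: block_effect_def fun_eq_iff)
  next
    case (Some vw)
    obtain v w where "vw = (v, w)" by fastforce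
    then show ?thesis using Some
      by (intro exI[of _ "if v div 2 \<noteq> w div 2 then 0 else 1 / ((fst (axis (v div 2)))\<^sup>2 + (snd (axis (v div 2)))\<^sup>2)"]
          exI[of _ "direction (v div 2) (v = w)"]) (auto simp: block_effect_def magic_entry_def fun_eq_iff)
  qed
  then show ?thesis unfolding effect_matrix_def using positive_operator_rank_one by metis
qed

lemma povm_effect_matrix:
  assumes x: "x \<in> {..<6} <+> {..<6}"
  shows "povm 2 ({..<6} <+> {..<6}) (effect_matrix x)"
  unfolding povm_def
proof (intro conjI ballI positive_effect_matrix)
  have "(\<Sum>a\<in>{..<6} <+> {..<6}. effect_matrix x a $$ (i, j)) = (if i = j then 1 else 0)"
    if ij: "i < 2" "j < 2" for i j
  proof -
    have "(\<Sum>a\<in>{..<6} <+> {..<6}. effect_matrix x a $$ (i, j))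
        = of_real (\<Sum>a\<in>{..<6} <+> {..<6}. block_effect x a i j)"
      using ij by (simp add: effect_matrix_def)
    also have "(\<Sum>a\<in>{..<6} <+> {..<6}. block_effect x a i j) = (if i = j then 1 else 0)"
      using x magic_entry_sum[OF _ ij] by (auto simp: sum.Plus block_effect_def)
    finally show ?thesis by simp
  qed
  then show "mat 2 2 (\<lambda>(i, j). \<Sum>a\<in>{..<6} <+> {..<6}. effect_matrix x a $$ (i, j)) = 1\<^sub>m 2"
    by (intro eq_matI) simp_all
qed

definition maximally_entangled :: "complex vec" where
  "maximally_entangled = vec (2 * 2) (\<lambda>k. if k = 0 \<or> k = 3 then of_real (1 / sqrt 2) else 0)"

lemma block_strategy_quantum:
  "complex_of_real (block_strategy x y a b)
    = (kronecker (effect_matrix x a) (effect_matrix y b) *\<^sub>v maximally_entangled) \<bullet>c maximally_entangled"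
proof -
  define X where "X = (\<lambda>i j. if i < 2 \<and> j < 2 then maximally_entangled $ (i * 2 + j) else 0)"
  define r where "r = complex_of_real (1 / sqrt 2)"
  have r: "r * r = 1 / 2" unfolding r_def by (simp flip: of_real_mult)
  have X: "X 0 0 = r" "X 0 (Suc 0) = 0" "X (Suc 0) 0 = 0" "X (Suc 0) (Suc 0) = r"
    by (simp_all add: X_def maximally_entangled_def r_def)
  have cr: "cnj r = r" by (simp add: r_def)
  have "(kronecker (effect_matrix x a) (effect_matrix y b) *\<^sub>v maximally_entangled) \<bullet>c maximally_entangled
      = (\<Sum>i<2. \<Sum>j<2. left_action 2 (effect_matrix x a) (right_action 2 (effect_matrix y b) X) i j * cnj (X i j))"
    by (rule kronecker_form[OF _ _ _ X_def]) (simp_all add: effect_matrix_def maximally_entangled_def)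
  also have "\<dots> = (\<Sum>i<2. \<Sum>j<2. of_real (block_effect x a i j * block_effect y b i j)) * (r * r)"
    by (simp add: lessThan_2 left_action_def right_action_def X cr effect_matrix_def algebra_simps)
  finally show ?thesis by (simp add: r block_strategy_def)
qed

lemma block_strategy_perfect: "perfect_q_strategy (Iso complete6 complete6) block_strategy"
  unfolding perfect_q_strategy_def
proof (intro conjI ballI impI)
  let ?Q = "{..<6::nat} <+> {..<6::nat}"
  have Q: "questA (Iso complete6 complete6) = ?Q" "questB (Iso complete6 complete6) = ?Q"
    "answA (Iso complete6 complete6) = ?Q" "answB (Iso complete6 complete6) = ?Q"
    "rule (Iso complete6 complete6) = iso_rule complete6 complete6"
    by (simp_all add: Iso_def Let_def)
  have "maximally_entangled \<bullet>c maximally_entangled = 1"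
    by (simp add: maximally_entangled_def scalar_prod_def numeral_eq_Suc flip: of_real_mult)
  then show "quantum_correlation (questA (Iso complete6 complete6)) (questB (Iso complete6 complete6))
      (answA (Iso complete6 complete6)) (answB (Iso complete6 complete6)) block_strategy"
    unfolding quantum_correlation_def Q
    using povm_effect_matrix block_strategy_quantum
    by (intro exI[of _ 2] exI[of _ maximally_entangled] exI[of _ effect_matrix]) (auto simp: maximally_entangled_def)
  fix x y a b
  assume "x \<in> questA (Iso complete6 complete6)" "y \<in> questB (Iso complete6 complete6)"
    "a \<in> answA (Iso complete6 complete6)" "b \<in> answB (Iso complete6 complete6)"
    and lose: "\<not> rule (Iso complete6 complete6) x y a b"
  then have in_Q: "x \<in> ?Q" "y \<in> ?Q" "a \<in> ?Q" "b \<in> ?Q" by (simp_all add: Q)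
  show "block_strategy x y a b = 0"
  proof (cases "sides x a = None \<or> sides y b = None")
    case True
    then show ?thesis by (auto simp: block_strategy_def block_effect_def)
  next
    case False
    then obtain v w v' w' where s: "sides x a = Some (v, w)" "sides y b = Some (v', w')" by auto
    have bounds: "v < 6" "w < 6" "v' < 6" "w' < 6"
      using in_Q s by (auto elim!: PlusE)
    have "(v = v') \<noteq> (w = w')"
      using lose s iso_rule_complete6[OF bounds(1,3,2,4)] by (auto simp: Q iso_rule_def)
    then show ?thesis
      using magic_orthogonal bounds s by (auto simp: block_strategy_def block_effect_def)
  qed
qed

text \<open>Wigner's inequality for the answers \<open>0\<close>, \<open>2\<close> or \<open>3\<close>, and \<open>5\<close> to the questions \<open>0\<close>, \<open>2\<close>, \<open>4\<close> would read
  \<open>8 / 25 \<le> 1 / 10 + 1 / 10\<close>.\<close>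

lemma block_strategy_not_for_HypIso:
  "\<not> perfect_q_strategy_for_HypIso complete6 complete6 block_strategy"
proof
  assume "perfect_q_strategy_for_HypIso complete6 complete6 block_strategy"
  then obtain p where p: "perfect_q_strategy (HypIso complete6 complete6) p"
    and agree: "\<forall>x\<in>{..<6} <+> {..<6}. \<forall>y\<in>{..<6} <+> {..<6}. \<forall>a\<in>{..<6} <+> {..<6}. \<forall>b\<in>{..<6} <+> {..<6}.
      block_strategy x y a b = p (Inl x) (Inl y) (Inl a) (Inl b)"
    unfolding perfect_q_strategy_for_HypIso_def Iso_def Let_def game.simps vertices_complete6 by (elim exE conjE)
  have restr: "p (vertex_question x) (vertex_question y) (vertex_answer a) (vertex_answer b)
      = block_strategy (Inl x) (Inl y) (Inr a) (Inr b)" if "x < 6" "y < 6" "a < 6" "b < 6" for x y a b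
    using agree that by (simp add: InlI InrI)
  note value_simps = block_strategy_def block_effect_def magic_entry_def direction_def axis_def lessThan_2
  have "p (vertex_question 0) (vertex_question 4) (vertex_answer 0) (vertex_answer 5)
    \<le> p (vertex_question 0) (vertex_question 2) (vertex_answer 0) (vertex_answer 3)
      + p (vertex_question 2) (vertex_question 4) (vertex_answer 2) (vertex_answer 5)"
  proof (rule HypIso_Wigner_inequality[OF simple_graph_complete6 simple_graph_complete6 p,
        where A = "{0, 1}"])
    show "\<forall>j\<in>vertices complete6 - {0, 1}.
        p (vertex_question 0) (vertex_question 0) (vertex_answer j) (vertex_answer j) = 0"
      by (auto simp: restr value_simps)
    show "\<forall>j\<in>vertices complete6 - {2, 3}.
        p (vertex_question 2) (vertex_question 2) (vertex_answer j) (vertex_answer j) = 0"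
    proof
      fix j assume "j \<in> vertices complete6 - {2, 3}"
      then have "j < 6" "j div 2 \<noteq> 1" by auto
      then show "p (vertex_question 2) (vertex_question 2) (vertex_answer j) (vertex_answer j) = 0"
        by (simp add: restr value_simps)
    qed
  qed (simp_all add: edge_complete6)
  then show False by (simp add: restr value_simps)
qed

section \<open>Evaluations and the involution of the free algebra\<close>

lemma letters_zero [simp]: "letters 0 = []"
  by (simp add: zero_word_def)

lemma poly_mapping_single_induct [case_names zero single add]:
  fixes f :: "'k \<Rightarrow>\<^sub>0 'c::comm_monoid_add"
  assumes "P 0" and "\<And>k c. P (Poly_Mapping.single k c)" and "\<And>f g. P f \<Longrightarrow> P g \<Longrightarrow> P (f + g)"
  shows "P f"
proof -
  have sum_singles: "f = (\<Sum>k\<in>Poly_Mapping.keys f. Poly_Mapping.single k (Poly_Mapping.lookup f k))"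
    by (rule poly_mapping_eqI)
      (auto simp: lookup_sum lookup_single when_def in_keys_iff sum.delta' intro!: sum.neutral)
  have "P (\<Sum>k\<in>K. Poly_Mapping.single k (Poly_Mapping.lookup f k))" for K
    by (induction K rule: infinite_finite_induct) (simp_all add: assms)
  then show ?thesis using sum_singles by metis
qed

lemma scalar_central:
  "Poly_Mapping.single 0 c * f = f * Poly_Mapping.single (0::'m::monoid_add) (c::complex)"
  by (induction f rule: poly_mapping_single_induct) (simp_all add: mult_single algebra_simps)

text \<open>The extension of \<open>\<rho>\<close> to a homomorphism of algebras.  Its target is an arbitrary monoid algebra over the
  complex numbers; this covers both other free algebras, for the canonical map, and the small algebra that
  separates elements of the graph game algebra.\<close>

definition evaluate :: "('g \<Rightarrow> ('m::monoid_add \<Rightarrow>\<^sub>0 complex)) \<Rightarrow> 'g free_elem \<Rightarrow> ('m \<Rightarrow>\<^sub>0 complex)" where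
  "evaluate \<rho> f = (\<Sum>w\<in>Poly_Mapping.keys f.
     Poly_Mapping.single 0 (Poly_Mapping.lookup f w) * prod_list (map \<rho> (letters w)))"

lemma evaluate_superset:
  assumes "finite K" "Poly_Mapping.keys f \<subseteq> K"
  shows "evaluate \<rho> f = (\<Sum>w\<in>K. Poly_Mapping.single 0 (Poly_Mapping.lookup f w) * prod_list (map \<rho> (letters w)))"
  unfolding evaluate_def by (rule sum.mono_neutral_left) (use assms in \<open>auto simp: in_keys_iff\<close>)

lemma evaluate_add: "evaluate \<rho> (f + g) = evaluate \<rho> f + evaluate \<rho> g"
proof -
  let ?K = "Poly_Mapping.keys f \<union> Poly_Mapping.keys g"
  have "evaluate \<rho> h = (\<Sum>w\<in>?K. Poly_Mapping.single 0 (Poly_Mapping.lookup h w) * prod_list (map \<rho> (letters w)))"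
    if "h \<in> {f, g, f + g}" for h
    by (rule evaluate_superset) (use that Poly_Mapping.keys_add[of f g] in auto)
  then show ?thesis by (simp add: lookup_add single_add distrib_right sum.distrib)
qed

lemma evaluate_zero: "evaluate \<rho> 0 = 0"
  by (simp add: evaluate_def)

lemma evaluate_single: "evaluate \<rho> (Poly_Mapping.single w c) = Poly_Mapping.single 0 c * prod_list (map \<rho> (letters w))"
  by (subst evaluate_superset[of "{w}"]) simp_all

lemma evaluate_mult: "evaluate \<rho> (f * g) = evaluate \<rho> f * evaluate \<rho> g"
proof (induction f rule: poly_mapping_single_induct)
  case (single w c)
  show ?case
  proof (induction g rule: poly_mapping_single_induct)
    case (single w' c')
    let ?s = "\<lambda>c. Poly_Mapping.single 0 c :: 'a \<Rightarrow>\<^sub>0 complex" and ?p = "\<lambda>w. prod_list (map \<rho> (letters w))"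
    have "evaluate \<rho> (Poly_Mapping.single w c * Poly_Mapping.single w' c') = ?s (c * c') * (?p w * ?p w')"
      by (simp add: mult_single evaluate_single plus_word_def)
    also have "?s (c * c') = ?s c * ?s c'" by (simp add: mult_single)
    also have "?s c * ?s c' * (?p w * ?p w') = ?s c * ((?s c' * ?p w) * ?p w')" by (simp add: mult.assoc)
    also have "?s c' * ?p w = ?p w * ?s c'" by (rule scalar_central)
    finally show ?case by (simp add: evaluate_single mult.assoc)
  qed (simp_all add: evaluate_zero evaluate_add distrib_left)
qed (simp_all add: evaluate_zero evaluate_add distrib_right)

lemma evaluate_one: "evaluate \<rho> 1 = 1"
  using evaluate_single[of \<rho> 0 1] by simp

lemma evaluate_gen: "evaluate \<rho> (gen x) = \<rho> x"
  by (simp add: gen_def evaluate_single)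

lemma evaluate_uminus: "evaluate \<rho> (- f) = - evaluate \<rho> f"
  using evaluate_add[of \<rho> f "- f"] by (simp add: evaluate_zero add_eq_0_iff)

lemma evaluate_diff: "evaluate \<rho> (f - g) = evaluate \<rho> f - evaluate \<rho> g"
  using evaluate_add[of \<rho> f "- g"] by (simp add: evaluate_uminus)

lemma evaluate_sum: "evaluate \<rho> (sum f A) = (\<Sum>a\<in>A. evaluate \<rho> (f a))"
  by (induction A rule: infinite_finite_induct) (simp_all add: evaluate_zero evaluate_add)

lemma star_zero: "star 0 = 0"
  by (rule poly_mapping_eqI) (simp add: lookup_star)

lemma star_add: "star (f + g) = star f + star g"
  by (rule poly_mapping_eqI) (simp add: lookup_star lookup_add)

lemma star_star: "star (star f) = f"
  by (rule poly_mapping_eqI) (simp add: lookup_star)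

lemma star_single: "star (Poly_Mapping.single w c) = Poly_Mapping.single (Word (rev (letters w))) (cnj c)"
proof (rule poly_mapping_eqI)
  fix k
  have "w = Word (rev (letters k)) \<longleftrightarrow> Word (rev (letters w)) = k"
    by (cases w; cases k) auto
  then show "Poly_Mapping.lookup (star (Poly_Mapping.single w c)) k
      = Poly_Mapping.lookup (Poly_Mapping.single (Word (rev (letters w))) (cnj c)) k"
    by (simp add: lookup_star lookup_single when_def)
qed

lemma star_mult: "star (f * g) = star g * star f"
proof (induction f rule: poly_mapping_single_induct)
  case (single w c)
  show ?case
    by (induction g rule: poly_mapping_single_induct)
      (simp_all add: mult_single star_single star_zero star_add distrib_left distrib_right plus_word_def mult.commute)
qed (simp_all add: star_zero star_add distrib_left distrib_right)

lemma star_gen: "star (gen x) = gen x"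
  by (simp add: gen_def star_single)

lemma star_one: "star 1 = 1"
  using star_single[of 0 1] by (simp flip: zero_word_def)

lemma star_uminus: "star (- f) = - star f"
  using star_add[of f "- f"] by (simp add: star_zero add_eq_0_iff)

lemma star_diff: "star (f - g) = star f - star g"
  using star_add[of f "- g"] by (simp add: star_uminus)

lemma star_sum: "star (sum f A) = (\<Sum>a\<in>A. star (f a))"
  by (induction A rule: infinite_finite_induct) (simp_all add: star_zero star_add)

section \<open>Ideals of the free algebra and game algebras\<close>

lemma free_algebra_simps [simp]:
  "f \<otimes>\<^bsub>free_algebra S\<^esub> g = f * g" "\<one>\<^bsub>free_algebra S\<^esub> = 1"
  "f \<oplus>\<^bsub>free_algebra S\<^esub> g = f + g" "\<zero>\<^bsub>free_algebra S\<^esub> = 0"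
  by (simp_all add: free_algebra_def)

lemma in_free_algebra: "f \<in> carrier (free_algebra S) \<longleftrightarrow> (\<forall>w\<in>Poly_Mapping.keys f. set (letters w) \<subseteq> S)"
  by (simp add: free_algebra_def)

lemma free_algebra_zero: "0 \<in> carrier (free_algebra S)"
  by (simp add: in_free_algebra)

lemma free_algebra_add:
  assumes "f \<in> carrier (free_algebra S)" "g \<in> carrier (free_algebra S)"
  shows "f + g \<in> carrier (free_algebra S)"
  using assms Poly_Mapping.keys_add[of f g] unfolding in_free_algebra by blast

lemma free_algebra_uminus: "f \<in> carrier (free_algebra S) \<Longrightarrow> - f \<in> carrier (free_algebra S)"
  by (simp add: in_free_algebra)

lemma free_algebra_diff:
  assumes "f \<in> carrier (free_algebra S)" "g \<in> carrier (free_algebra S)"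
  shows "f - g \<in> carrier (free_algebra S)"
  using free_algebra_add[OF assms(1) free_algebra_uminus[OF assms(2)]] by simp

lemma free_algebra_mult:
  assumes "f \<in> carrier (free_algebra S)" "g \<in> carrier (free_algebra S)"
  shows "f * g \<in> carrier (free_algebra S)"
  unfolding in_free_algebra
proof
  fix w assume "w \<in> Poly_Mapping.keys (f * g)"
  then obtain a b where "w = a + b" "a \<in> Poly_Mapping.keys f" "b \<in> Poly_Mapping.keys g"
    using keys_mult[of f g] by blast
  then show "set (letters w) \<subseteq> S"
    using assms by (auto simp: in_free_algebra plus_word_def)
qed

lemma free_algebra_scalar: "scalar c \<in> carrier (free_algebra S)"
  by (simp add: in_free_algebra scalar_def zero_word_def)

lemma free_algebra_one: "1 \<in> carrier (free_algebra S)"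
  using free_algebra_scalar[of 1] by (simp add: scalar_def)

lemma free_algebra_gen: "x \<in> S \<Longrightarrow> gen x \<in> carrier (free_algebra S)"
  by (simp add: in_free_algebra gen_def)

lemma free_algebra_sum:
  "(\<And>a. a \<in> A \<Longrightarrow> f a \<in> carrier (free_algebra S)) \<Longrightarrow> sum f A \<in> carrier (free_algebra S)"
  by (induction A rule: infinite_finite_induct) (simp_all add: free_algebra_zero free_algebra_add)

lemma free_algebra_star:
  assumes "f \<in> carrier (free_algebra S)"
  shows "star f \<in> carrier (free_algebra S)"
  unfolding in_free_algebra
proof
  fix w assume "w \<in> Poly_Mapping.keys (star f)"
  then have "Word (rev (letters w)) \<in> Poly_Mapping.keys f" by (simp add: in_keys_iff lookup_star)
  then have "set (letters (Word (rev (letters w)))) \<subseteq> S" using assms unfolding in_free_algebra by blast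
  then show "set (letters w) \<subseteq> S" by simp
qed

lemmas free_algebra_closed = free_algebra_zero free_algebra_one free_algebra_add free_algebra_uminus
  free_algebra_diff free_algebra_mult free_algebra_scalar free_algebra_gen free_algebra_sum free_algebra_star

lemma ring_free_algebra: "ring (free_algebra S)"
proof (rule ringI)
  show "abelian_group (free_algebra S)"
  proof (rule abelian_groupI)
    show "\<exists>g\<in>carrier (free_algebra S). g \<oplus>\<^bsub>free_algebra S\<^esub> f = \<zero>\<^bsub>free_algebra S\<^esub>"
      if "f \<in> carrier (free_algebra S)" for f
      using that by (intro bexI[of _ "- f"]) (simp_all add: free_algebra_closed)
  qed (simp_all add: free_algebra_closed algebra_simps)
  show "monoid (free_algebra S)"
    by (rule monoidI) (simp_all add: free_algebra_closed algebra_simps)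
qed (simp_all add: algebra_simps)

text \<open>Additive inverses are obtained by multiplication with \<open>-1\<close>.\<close>

lemma free_algebra_idealI:
  assumes "J \<subseteq> carrier (free_algebra S)" "0 \<in> J" "\<And>f g. f \<in> J \<Longrightarrow> g \<in> J \<Longrightarrow> f + g \<in> J"
    and l: "\<And>f g. f \<in> carrier (free_algebra S) \<Longrightarrow> g \<in> J \<Longrightarrow> f * g \<in> J"
    and r: "\<And>f g. f \<in> carrier (free_algebra S) \<Longrightarrow> g \<in> J \<Longrightarrow> g * f \<in> J"
  shows "ideal J (free_algebra S)"
proof -
  interpret ring "free_algebra S" by (rule ring_free_algebra)
  show ?thesis
  proof (rule idealI[OF ring_free_algebra])
    show "subgroup J (add_monoid (free_algebra S))"
    proof (rule add.subgroupI)
      show "\<ominus>\<^bsub>free_algebra S\<^esub> f \<in> J" if f: "f \<in> J" for f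
      proof -
        have "- f = \<ominus>\<^bsub>free_algebra S\<^esub> f"
          using f assms(1) by (intro minus_equality[symmetric]) (auto simp: free_algebra_closed)
        moreover have "- 1 * f \<in> J" by (rule l[OF free_algebra_uminus[OF free_algebra_one] f])
        ultimately show ?thesis by simp
      qed
    qed (use assms in \<open>auto simp: free_algebra_def\<close>)
  qed (use l r in auto)
qed

lemma free_algebra_idealD:
  assumes "ideal J (free_algebra S)"
  shows "J \<subseteq> carrier (free_algebra S)" "0 \<in> J" "f \<in> J \<Longrightarrow> g \<in> J \<Longrightarrow> f + g \<in> J"
    "h \<in> carrier (free_algebra S) \<Longrightarrow> f \<in> J \<Longrightarrow> h * f \<in> J"
    "h \<in> carrier (free_algebra S) \<Longrightarrow> f \<in> J \<Longrightarrow> f * h \<in> J"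
    "f \<in> J \<Longrightarrow> - f \<in> J" "f \<in> J \<Longrightarrow> g \<in> J \<Longrightarrow> f - g \<in> J"
proof -
  interpret ideal J "free_algebra S" by (rule assms)
  show "J \<subseteq> carrier (free_algebra S)" using a_subset .
  show "0 \<in> J" using additive_subgroup.zero_closed[OF ideal.axioms(1)[OF assms]] by simp
  show add: "f \<in> J \<Longrightarrow> g \<in> J \<Longrightarrow> f + g \<in> J" for f g using additive_subgroup.a_closed[OF ideal.axioms(1)[OF assms], of f g] by simp
  show l: "h \<in> carrier (free_algebra S) \<Longrightarrow> f \<in> J \<Longrightarrow> h * f \<in> J" for h f
    using I_l_closed[of f h] by simp
  show "h \<in> carrier (free_algebra S) \<Longrightarrow> f \<in> J \<Longrightarrow> f * h \<in> J"
    using I_r_closed[of f h] by simp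
  show um: "f \<in> J \<Longrightarrow> - f \<in> J" for f using l[OF free_algebra_uminus[OF free_algebra_one], of f] by simp
  show "f \<in> J \<Longrightarrow> g \<in> J \<Longrightarrow> f - g \<in> J" using add[of f "- g"] um[of g] by simp
qed

abbreviation game_free_algebra :: "('x, 'x, 'a, 'a) game \<Rightarrow> ('x \<times> 'a) free_elem ring" where
  "game_free_algebra G \<equiv> free_algebra (game_generators G)"

lemma game_relations_closed: "game_relations G \<subseteq> carrier (game_free_algebra G)"
  by (auto simp: game_relations_def game_generators_def intro!: free_algebra_closed)

lemma game_ideal_ideal: "ideal (game_ideal G) (game_free_algebra G)"
  unfolding game_ideal_def
  by (rule ring.genideal_ideal[OF ring_free_algebra])
    (use game_relations_closed free_algebra_star in blast)

lemmas game_ideal_closed = free_algebra_idealD[OF game_ideal_ideal]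

lemma game_relations_in_ideal: "game_relations G \<subseteq> game_ideal G" "star ` game_relations G \<subseteq> game_ideal G"
  unfolding game_ideal_def
  using ring.genideal_self[OF ring_free_algebra, of "game_relations G \<union> star ` game_relations G" "game_generators G"]
    game_relations_closed free_algebra_star by blast+

text \<open>To show that a property holds on the game ideal, it suffices that it defines an ideal and holds for
  the relations and their adjoints.\<close>

lemma game_ideal_least:
  assumes "ideal J (game_free_algebra G)" "\<And>r. r \<in> game_relations G \<Longrightarrow> r \<in> J \<and> star r \<in> J"
  shows "game_ideal G \<subseteq> J"
  unfolding game_ideal_def
  by (rule ring.genideal_minimal[OF ring_free_algebra assms(1)]) (use assms(2) in blast)

lemma game_ideal_star:
  assumes "f \<in> game_ideal G"
  shows "star f \<in> game_ideal G"
proof -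
  let ?J = "{f \<in> carrier (game_free_algebra G). star f \<in> game_ideal G}"
  have "ideal ?J (game_free_algebra G)"
    by (rule free_algebra_idealI)
      (simp_all add: star_zero star_add star_mult game_ideal_closed(2-5) free_algebra_closed subset_iff)
  then have "game_ideal G \<subseteq> ?J"
  proof (rule game_ideal_least)
    fix r assume r: "r \<in> game_relations G"
    have "r \<in> carrier (game_free_algebra G)" using r game_relations_closed by blast
    moreover have "r \<in> game_ideal G" "star r \<in> game_ideal G" using r game_relations_in_ideal by blast+
    ultimately show "r \<in> ?J \<and> star r \<in> ?J" by (simp add: star_star free_algebra_star)
  qed
  then show ?thesis using assms by blast
qed

lemma game_class_eq: "game_class G f = (\<lambda>i. i + f) ` game_ideal G"
  by (auto simp: game_class_def a_r_coset_def')

lemma game_class_eq_iff: "game_class G f = game_class G g \<longleftrightarrow> f - g \<in> game_ideal G"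
proof
  assume "game_class G f = game_class G g"
  moreover have "f \<in> game_class G f" unfolding game_class_eq by (rule image_eqI[of _ _ 0]) (simp_all add: game_ideal_closed(2))
  ultimately obtain i where "f = i + g" "i \<in> game_ideal G" by (auto simp: game_class_eq)
  then show "f - g \<in> game_ideal G" by simp
next
  assume d: "f - g \<in> game_ideal G"
  have sub: "game_class G h \<subseteq> game_class G k" if "h - k \<in> game_ideal G" for h k
  proof
    fix t assume "t \<in> game_class G h"
    then obtain i where i: "t = i + h" "i \<in> game_ideal G" by (auto simp: game_class_eq)
    have "i + (h - k) \<in> game_ideal G" by (rule game_ideal_closed(3)[OF i(2) that])
    moreover have "t = (i + (h - k)) + k" using i(1) by simp
    ultimately show "t \<in> game_class G k" unfolding game_class_eq by (rule rev_image_eqI)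
  qed
  show "game_class G f = game_class G g"
    using sub[OF d] sub[of g f] game_ideal_closed(6)[OF d] by simp
qed

lemma game_class_hom: "game_class G \<in> Ring.ring_hom (game_free_algebra G) (game_algebra G)"
  unfolding game_algebra_def game_class_def by (rule ideal.rcos_ring_hom[OF game_ideal_ideal])

lemma game_class_closed:
  "f \<in> carrier (game_free_algebra G) \<Longrightarrow> game_class G f \<in> carrier (game_algebra G)"
  by (rule ring_hom_closed[OF game_class_hom])

lemma game_class_simps:
  assumes "f \<in> carrier (game_free_algebra G)" "g \<in> carrier (game_free_algebra G)"
  shows "game_class G (f * g) = game_class G f \<otimes>\<^bsub>game_algebra G\<^esub> game_class G g"
    and "game_class G (f + g) = game_class G f \<oplus>\<^bsub>game_algebra G\<^esub> game_class G g"
  using ring_hom_mult[OF game_class_hom assms] ring_hom_add[OF game_class_hom assms] by simp_all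

lemma game_class_one: "game_class G 1 = \<one>\<^bsub>game_algebra G\<^esub>"
  using ring_hom_one[OF game_class_hom] by simp

lemma game_algebra_carrier: "carrier (game_algebra G) = game_class G ` carrier (game_free_algebra G)"
  by (auto simp: game_algebra_def FactRing_def A_RCOSETS_def' game_class_def)

lemma star_game_class: "star ` game_class G f = game_class G (star f)"
proof -
  have "star ` game_ideal G = game_ideal G"
  proof
    show "star ` game_ideal G \<subseteq> game_ideal G" using game_ideal_star by blast
    show "game_ideal G \<subseteq> star ` game_ideal G"
    proof
      fix f assume "f \<in> game_ideal G"
      then show "f \<in> star ` game_ideal G"
        by (intro image_eqI[of f star "star f"] game_ideal_star) (simp_all add: star_star)
    qed
  qed
  moreover have "star ` game_class G f = (\<lambda>i. i + star f) ` star ` game_ideal G"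
    by (simp add: game_class_eq image_image star_add)
  ultimately show ?thesis by (simp add: game_class_eq)
qed

lemma losing_product_in_ideal:
  assumes "x \<in> questA G" "y \<in> questA G" "a \<in> answA G" "b \<in> answA G" "\<not> rule G x y a b"
  shows "gen (x, a) * gen (y, b) \<in> game_ideal G"
  using assms game_relations_in_ideal(1)[of G] unfolding game_relations_def by blast

lemma idempotent_in_ideal:
  assumes "x \<in> questA G" "a \<in> answA G"
  shows "gen (x, a) * gen (x, a) - gen (x, a) \<in> game_ideal G"
  using assms game_relations_in_ideal(1)[of G] unfolding game_relations_def by blast

lemma generator_in_game_algebra:
  assumes "x \<in> questA G" "a \<in> answA G"
  shows "gen (x, a) \<in> carrier (game_free_algebra G)"
  using assms by (intro free_algebra_gen) (simp add: game_generators_def)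

section \<open>The canonical homomorphism\<close>

definition relabel :: "('g \<Rightarrow> 'h) \<Rightarrow> 'g free_elem \<Rightarrow> 'h free_elem" where
  "relabel h = evaluate (\<lambda>x. gen (h x))"

lemma relabel_single: "relabel h (Poly_Mapping.single w c) = Poly_Mapping.single (Word (map h (letters w))) c"
proof -
  have "prod_list (map (\<lambda>x. gen (h x)) l) = Poly_Mapping.single (Word (map h l)) 1" for l
    by (induction l) (simp_all add: gen_def mult_single plus_word_def flip: zero_word_def)
  then show ?thesis by (simp add: relabel_def evaluate_single mult_single)
qed

lemmas relabel_simps = evaluate_zero[of "\<lambda>x. gen (h x)" for h, folded relabel_def]
  evaluate_one[of "\<lambda>x. gen (h x)" for h, folded relabel_def]
  evaluate_add[of "\<lambda>x. gen (h x)" for h, folded relabel_def]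
  evaluate_diff[of "\<lambda>x. gen (h x)" for h, folded relabel_def]
  evaluate_mult[of "\<lambda>x. gen (h x)" for h, folded relabel_def]
  evaluate_sum[of "\<lambda>x. gen (h x)" for h, folded relabel_def]
  evaluate_gen[of "\<lambda>x. gen (h x)" for h, folded relabel_def]

lemma relabel_star: "relabel h (star f) = star (relabel h f)"
  by (induction f rule: poly_mapping_single_induct)
    (simp_all add: relabel_simps(1,3) star_zero star_add star_single relabel_single rev_map)

lemma relabel_scalar: "relabel h (scalar c) = scalar c"
  using relabel_single[of h 0 c] by (simp add: scalar_def flip: zero_word_def)

lemma relabel_closed:
  assumes "f \<in> carrier (free_algebra S)" "h ` S \<subseteq> T"
  shows "relabel h f \<in> carrier (free_algebra T)"
  unfolding relabel_def evaluate_def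
proof (intro free_algebra_sum free_algebra_mult)
  fix w assume w: "w \<in> Poly_Mapping.keys f"
  show "Poly_Mapping.single 0 (Poly_Mapping.lookup f w) \<in> carrier (free_algebra T)"
    using free_algebra_scalar unfolding scalar_def .
  have "set (letters w) \<subseteq> S" using assms(1) w unfolding in_free_algebra by blast
  then have "set l \<subseteq> S \<Longrightarrow> prod_list (map (\<lambda>x. gen (h x)) l) \<in> carrier (free_algebra T)" for l
    using assms(2) by (induction l) (auto intro!: free_algebra_one free_algebra_mult free_algebra_gen)
  then show "prod_list (map (\<lambda>x. gen (h x)) (letters w)) \<in> carrier (free_algebra T)"
    using \<open>set (letters w) \<subseteq> S\<close> by blast
qed

text \<open>The homomorphism on cosets is the union of the cosets of the relabelled representatives, which are
  all the same coset because the relabelling maps the relations into the target ideal.\<close>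

lemma game_star_hom_of_relabelling:
  assumes gens: "h ` game_generators G \<subseteq> game_generators H"
    and rels: "\<forall>r\<in>game_relations G. relabel h r \<in> game_ideal H"
  obtains \<phi> where "game_star_hom G H \<phi>" "\<And>f. \<phi> (game_class G f) = game_class H (relabel h f)"
proof
  define \<phi> where "\<phi> = (\<lambda>C. \<Union>f\<in>C. game_class H (relabel h f))"
  let ?J = "{f \<in> carrier (game_free_algebra G). relabel h f \<in> game_ideal H}"
  have "ideal ?J (game_free_algebra G)"
    by (rule free_algebra_idealI)
      (simp_all add: relabel_simps game_ideal_closed(2-5) free_algebra_closed relabel_closed[OF _ gens] subset_iff)
  then have "game_ideal G \<subseteq> ?J"
  proof (rule game_ideal_least)
    fix r assume r: "r \<in> game_relations G"
    then have "r \<in> carrier (game_free_algebra G)" using game_relations_closed by blast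
    then show "r \<in> ?J \<and> star r \<in> ?J"
      using bspec[OF rels r] by (simp add: free_algebra_star relabel_star game_ideal_star)
  qed
  then have ideal: "relabel h i \<in> game_ideal H" if "i \<in> game_ideal G" for i using that by blast
  show on_class: "\<phi> (game_class G f) = game_class H (relabel h f)" for f
  proof -
    have "game_class H (relabel h f') = game_class H (relabel h f)" if f': "f' \<in> game_class G f" for f'
    proof -
      obtain i where "f' = i + f" "i \<in> game_ideal G" using f' by (auto simp: game_class_eq)
      then show ?thesis using ideal by (simp add: game_class_eq_iff relabel_simps)
    qed
    moreover have "f \<in> game_class G f"
      unfolding game_class_eq by (rule image_eqI[of _ _ 0]) (simp_all add: game_ideal_closed(2))
    ultimately show ?thesis unfolding \<phi>_def by blast
  qed
  show "game_star_hom G H \<phi>"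
    unfolding game_star_hom_def
  proof (intro conjI allI ballI)
    have closed: "relabel h f \<in> carrier (game_free_algebra H)" if "f \<in> carrier (game_free_algebra G)" for f
      by (rule relabel_closed[OF that gens])
    show "\<phi> \<in> Ring.ring_hom (game_algebra G) (game_algebra H)"
    proof (rule ring_hom_memI)
      fix C assume "C \<in> carrier (game_algebra G)"
      then obtain f where f: "C = game_class G f" "f \<in> carrier (game_free_algebra G)"
        by (auto simp: game_algebra_carrier)
      then show "\<phi> C \<in> carrier (game_algebra H)"
        by (simp add: on_class game_class_closed closed)
      fix D assume "D \<in> carrier (game_algebra G)"
      then obtain g where g: "D = game_class G g" "g \<in> carrier (game_free_algebra G)"
        by (auto simp: game_algebra_carrier)
      show "\<phi> (C \<otimes>\<^bsub>game_algebra G\<^esub> D) = \<phi> C \<otimes>\<^bsub>game_algebra H\<^esub> \<phi> D"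
        by (simp add: f g on_class closed relabel_simps flip: game_class_simps)
      show "\<phi> (C \<oplus>\<^bsub>game_algebra G\<^esub> D) = \<phi> C \<oplus>\<^bsub>game_algebra H\<^esub> \<phi> D"
        by (simp add: f g on_class closed relabel_simps flip: game_class_simps)
    next
      show "\<phi> \<one>\<^bsub>game_algebra G\<^esub> = \<one>\<^bsub>game_algebra H\<^esub>"
        by (simp add: on_class relabel_simps flip: game_class_one)
    qed
    show "\<phi> (game_class G (scalar c)) = game_class H (scalar c)" for c
      by (simp add: on_class relabel_scalar)
    show "\<phi> (star ` C) = star ` \<phi> C" if "C \<in> carrier (game_algebra G)" for C
    proof -
      obtain f where f: "C = game_class G f" using \<open>C \<in> carrier (game_algebra G)\<close> by (auto simp: game_algebra_carrier)
      show ?thesis by (simp only: f star_game_class on_class relabel_star)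
    qed
  qed
qed

text \<open>The relations of the graph game hold in the algebra of the hypergraph game because adjacency
  of vertices in a simple graph means the same in both games.  The one point to check is that the sum over
  all answers to a vertex question in the hypergraph game reduces to the sum over vertices.\<close>

lemma canonical_map_exists:
  fixes G1 :: "'v hgraph" and G2 :: "'w hgraph"
  assumes G: "simple_graph G1" "simple_graph G2"
  obtains \<phi> where "canonical_iso_hypiso_map G1 G2 \<phi>"
    "\<And>f. \<phi> (game_class (Iso G1 G2) f) = game_class (HypIso G1 G2) (relabel (map_prod Inl Inl) f)"
proof -
  let ?I = "Iso G1 G2" and ?H = "HypIso G1 G2"
  define V where "V = vertices G1 <+> vertices G2"
  define E where "E = hyperedges G1 <+> hyperedges G2"
  have I: "questA ?I = V" "answA ?I = V" "rule ?I = iso_rule G1 G2"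
    by (simp_all add: Iso_def V_def Let_def)
  have H: "questA ?H = V <+> E" "answA ?H = V <+> E" "rule ?H = hypiso_rule G1 G2"
    by (simp_all add: HypIso_def V_def E_def Let_def)
  have fin: "finite V" "finite E"
    using G[THEN finite_simple_graph(1)] G[THEN finite_simple_graph(2)] by (simp_all add: V_def E_def)
  \<comment> \<open>an answer of the wrong type loses against itself, so its square and hence the idempotent is zero\<close>
  have wrong_type: "gen (Inl x, Inr e) \<in> game_ideal ?H" if "x \<in> V" "e \<in> E" for x e
  proof -
    have q: "Inl x \<in> questA ?H" and a: "Inr e \<in> answA ?H" using that by (auto simp: H)
    have "gen (Inl x, Inr e) * gen (Inl x, Inr e) \<in> game_ideal ?H"
      by (rule losing_product_in_ideal[OF q q a a]) (simp add: H)
    from game_ideal_closed(7)[OF this idempotent_in_ideal[OF q a]] show ?thesis by simp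
  qed
  have gens: "map_prod Inl Inl ` game_generators ?I \<subseteq> game_generators ?H"
    by (auto simp: game_generators_def I H)
  have rels: "\<forall>r\<in>game_relations ?I. relabel (map_prod Inl Inl) r \<in> game_ideal ?H"
  proof
    fix r assume "r \<in> game_relations ?I"
    then consider (idem) x a where "x \<in> V" "a \<in> V" "r = gen (x, a) * gen (x, a) - gen (x, a)"
      | (sum) x where "x \<in> V" "r = (\<Sum>a\<in>V. gen (x, a)) - 1"
      | (lose) x y a b where "x \<in> V" "y \<in> V" "a \<in> V" "b \<in> V" "\<not> iso_rule G1 G2 x y a b" "r = gen (x, a) * gen (y, b)"
      unfolding game_relations_def I by blast
    then show "relabel (map_prod Inl Inl) r \<in> game_ideal ?H"
    proof cases
      case idem
      then show ?thesis using idempotent_in_ideal[of "Inl x" ?H "Inl a"] by (simp add: relabel_simps H InlI)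
    next
      case sum
      have total: "(\<Sum>a\<in>V <+> E. gen (Inl x, a)) - 1 \<in> game_ideal ?H"
        using game_relations_in_ideal(1)[of ?H] sum(1) unfolding game_relations_def H by blast
      have rest: "(\<Sum>e\<in>W. gen (Inl x, Inr e)) \<in> game_ideal ?H" if "W \<subseteq> E" for W
        using that wrong_type sum(1)
        by (induction W rule: infinite_finite_induct) (auto intro!: game_ideal_closed(2,3))
      from game_ideal_closed(7)[OF total rest[OF subset_refl]] show ?thesis by (simp add: sum(2) relabel_simps sum.Plus fin)
    next
      case lose
      then have "gen (Inl x, Inl a) * gen (Inl y, Inl b) \<in> game_ideal ?H"
        by (intro losing_product_in_ideal)
          (auto simp: H iso_rule_def hypergraph_relation_simple_graph[OF G(1)] hypergraph_relation_simple_graph[OF G(2)])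
      then show ?thesis by (simp add: lose(6) relabel_simps)
    qed
  qed
  obtain \<phi> where \<phi>: "game_star_hom ?I ?H \<phi>"
    and on_class: "\<And>f. \<phi> (game_class ?I f) = game_class ?H (relabel (map_prod Inl Inl) f)"
    by (rule game_star_hom_of_relabelling[OF gens rels]) (rule that)
  have "canonical_iso_hypiso_map G1 G2 \<phi>"
    unfolding canonical_iso_hypiso_map_def using \<phi> by (simp add: on_class relabel_simps)
  then show ?thesis using that on_class by blast
qed

section \<open>Commutation along edges in the hypergraph game algebra\<close>

text \<open>Inserting \<open>1 = \<Sum>\<^sub>z e\<^bsub>x,z\<^esub>\<close> between two factors leaves only the answers \<open>z\<close> that are compatible with both.\<close>

lemma partition_of_unity:
  assumes x: "x \<in> questA G" and fin: "finite (answA G)" and Z: "Z \<subseteq> answA G"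
    and f: "f \<in> carrier (game_free_algebra G)" and g: "g \<in> carrier (game_free_algebra G)"
    and null: "\<And>z. z \<in> answA G \<Longrightarrow> z \<notin> Z \<Longrightarrow> f * gen (x, z) * g \<in> game_ideal G"
  shows "game_class G (f * g) = game_class G (\<Sum>z\<in>Z. f * gen (x, z) * g)"
proof -
  have "(\<Sum>z\<in>answA G. gen (x, z)) - 1 \<in> game_ideal G"
    using x game_relations_in_ideal(1)[of G] unfolding game_relations_def by blast
  then have total: "f * ((\<Sum>z\<in>answA G. gen (x, z)) - 1) * g \<in> game_ideal G"
    using f g by (intro game_ideal_closed(4,5))
  have rest: "(\<Sum>z\<in>W. f * gen (x, z) * g) \<in> game_ideal G" if "W \<subseteq> answA G - Z" for W
    using that null by (induction W rule: infinite_finite_induct) (auto intro!: game_ideal_closed(2,3))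
  have "f * g - (\<Sum>z\<in>Z. f * gen (x, z) * g)
      = (\<Sum>z\<in>answA G - Z. f * gen (x, z) * g) - f * ((\<Sum>z\<in>answA G. gen (x, z)) - 1) * g"
    using sum.subset_diff[OF Z fin, of "\<lambda>z. f * gen (x, z) * g"]
    by (simp add: algebra_simps sum_distrib_left sum_distrib_right)
  then have "f * g - (\<Sum>z\<in>Z. f * gen (x, z) * g) \<in> game_ideal G"
    using game_ideal_closed(7)[OF rest[OF subset_refl] total] by simp
  then show ?thesis by (simp add: game_class_eq_iff)
qed

text \<open>The hypotheses describe \<open>u = u\<^bsub>v,i\<^esub>\<close>, \<open>u' = u\<^bsub>v,j\<^esub>\<close>, \<open>w = u\<^bsub>w,j\<^esub>\<close>, \<open>w' = u\<^bsub>w,i\<^esub>\<close> and the generator \<open>g\<close> that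
  answers the edge \<open>{v, w}\<close> by \<open>{i, j}\<close>.  First \<open>u\<close> commutes with \<open>g\<close>, since both products are \<open>u g u\<close>.  Then
  both \<open>u w\<close> and \<open>w u\<close> equal \<open>u g\<close>: the edge element already determines the answer to \<open>w\<close> once the
  answer to \<open>v\<close> is known.\<close>

lemma (in ring) commute_through_edge_element:
  assumes c: "u \<in> carrier R" "u' \<in> carrier R" "w \<in> carrier R" "w' \<in> carrier R" "g \<in> carrier R"
    and g: "g = g \<otimes> u \<oplus> g \<otimes> u'" "g = u \<otimes> g \<oplus> u' \<otimes> g" "g = g \<otimes> w \<oplus> g \<otimes> w'" "g = w \<otimes> g \<oplus> w' \<otimes> g"
    and z: "u \<otimes> g \<otimes> u' = \<zero>" "u' \<otimes> g \<otimes> u = \<zero>" "u \<otimes> w' = \<zero>" "w' \<otimes> u = \<zero>"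
    and uw: "u \<otimes> w = u \<otimes> g \<otimes> w" and wu: "w \<otimes> u = w \<otimes> g \<otimes> u"
  shows "u \<otimes> w = w \<otimes> u"
proof -
  have "u \<otimes> g = u \<otimes> (g \<otimes> u \<oplus> g \<otimes> u')" using g(1) by simp
  also have "\<dots> = u \<otimes> g \<otimes> u" using c z(1) by (simp add: r_distr m_assoc)
  also have "\<dots> = (u \<otimes> g \<oplus> u' \<otimes> g) \<otimes> u" using c z(2) by (simp add: l_distr)
  also have "\<dots> = g \<otimes> u" using g(2) by simp
  finally have commute: "u \<otimes> g = g \<otimes> u" .
  have "u \<otimes> w = u \<otimes> g \<otimes> w \<oplus> u \<otimes> g \<otimes> w'"
    using uw commute c z(3) by (simp add: m_assoc)
  also have "\<dots> = u \<otimes> (g \<otimes> w \<oplus> g \<otimes> w')" using c by (simp add: r_distr m_assoc)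
  also have "\<dots> = (w \<otimes> g \<oplus> w' \<otimes> g) \<otimes> u" using g(3,4) commute by simp
  also have "\<dots> = w \<otimes> g \<otimes> u \<oplus> w' \<otimes> (u \<otimes> g)" using c commute by (simp add: l_distr m_assoc)
  also have "\<dots> = w \<otimes> u" using c z(4) wu by (simp flip: m_assoc)
  finally show ?thesis .
qed

text \<open>The preceding lemma applies by losing products and partitions of unity: one over the answers to the edge
  \<open>{v, w}\<close>, of which only \<open>{i, j}\<close> contains both \<open>i\<close> and \<open>j\<close>, and one over the answers to \<open>v\<close> or to \<open>w\<close>, of
  which only \<open>i\<close> and \<open>j\<close> lie in \<open>{i, j}\<close>.\<close>

lemma HypIso_adjacent_entries_commute:
  fixes G1 :: "'v hgraph" and G2 :: "'w hgraph"
  defines "H \<equiv> HypIso G1 G2"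
  assumes G: "simple_graph G1" "simple_graph G2"
    and e: "{v, w} \<in> hyperedges G1" "v \<noteq> w" and f: "{i, j} \<in> hyperedges G2" "i \<noteq> j"
  shows "game_class H (gen (vertex_question v, vertex_answer i) * gen (vertex_question w, vertex_answer j))
    = game_class H (gen (vertex_question w, vertex_answer j) * gen (vertex_question v, vertex_answer i))"
proof -
  let ?F = "carrier (game_free_algebra H)"
  let ?cl = "game_class H"
  interpret ring "game_algebra H"
    unfolding game_algebra_def by (rule ideal.quotient_is_ring[OF game_ideal_ideal])
  have rule: "rule H = hypiso_rule G1 G2" by (simp add: H_def HypIso_def Let_def)
  have in_H: "v \<in> vertices G1" "w \<in> vertices G1" "i \<in> vertices G2" "j \<in> vertices G2"
    using G e(1) f(1) by (auto simp: simple_graph_def)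
  have questions: "vertex_question v \<in> questA H" "vertex_question w \<in> questA H" "edge_question {v, w} \<in> questA H"
    using in_H e by (auto simp: H_def HypIso_def Let_def)
  have answers: "vertex_answer i \<in> answA H" "vertex_answer j \<in> answA H" "edge_answer {i, j} \<in> answA H"
    using in_H f by (auto simp: H_def HypIso_def Let_def)
  have edge_answers: "f' \<in> hyperedges G2" if "edge_answer f' \<in> answA H" for f'
    using that by (auto simp: H_def HypIso_def Let_def)
  have fin: "finite (answA H)" unfolding H_def by (rule finite_HypIso(1)[OF G])
  define g where "g = gen (edge_question {v, w} :: ('v, 'w) hyp_item, edge_answer {i, j} :: ('v, 'w) hyp_item)"
  define U where "U = (\<lambda>x y. gen (vertex_question x :: ('v, 'w) hyp_item, vertex_answer y :: ('v, 'w) hyp_item))"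
  have gF: "g \<in> ?F" unfolding g_def by (rule generator_in_game_algebra[OF questions(3) answers(3)])
  have UF: "U x y \<in> ?F" if "x \<in> {v, w}" "y \<in> {i, j}" for x y
    using that questions answers unfolding U_def by (blast intro: generator_in_game_algebra)
  have null: "gen (x, a) * gen (y, b) \<in> game_ideal H"
    if "x \<in> questA H" "y \<in> questA H" "a \<in> answA H" "b \<in> answA H" "\<not> hypiso_rule G1 G2 x y a b" for x y a b
    using losing_product_in_ideal[of x H y a b] that rule by simp
  \<comment> \<open>only the edge \<open>{i, j}\<close> contains both \<open>i\<close> and \<open>j\<close>\<close>
  have through_edge: "?cl (U x y * U x' y') = ?cl (U x y * g * U x' y')"
    if xx: "x \<in> {v, w}" "x' \<in> {v, w}" "{y, y'} = {i, j}" for x y x' y'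
  proof -
    have y: "y \<in> {i, j}" "y' \<in> {i, j}" "y \<noteq> y'" using xx(3) f(2) by (auto simp: doubleton_eq_iff)
    have "?cl (U x y * U x' y') = ?cl (\<Sum>z\<in>{edge_answer {i, j}}. U x y * gen (edge_question {v, w}, z) * U x' y')"
    proof (rule partition_of_unity[OF questions(3) fin _ UF[OF xx(1) y(1)] UF[OF xx(2) y(2)]])
      fix z assume z: "z \<in> answA H" "z \<notin> {edge_answer {i, j}}"
      have qa: "vertex_question x \<in> questA H" "vertex_question x' \<in> questA H"
        "vertex_answer y \<in> answA H" "vertex_answer y' \<in> answA H"
        using xx y questions answers by blast+
      have zF: "gen (edge_question {v, w}, z) \<in> ?F" by (rule generator_in_game_algebra[OF questions(3) z(1)])
      show "U x y * gen (edge_question {v, w}, z) * U x' y' \<in> game_ideal H"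
      proof (cases "hypiso_rule G1 G2 (vertex_question x) (edge_question {v, w}) (vertex_answer y) z")
        case False
        then have "U x y * gen (edge_question {v, w}, z) \<in> game_ideal H"
          unfolding U_def by (intro null qa questions z)
        then show ?thesis by (rule game_ideal_closed(5)[OF UF[OF xx(2) y(2)]])
      next
        case True
        then obtain f' where f': "z = edge_answer f'" "y \<in> f'"
          unfolding hypiso_rule_incident_swapped(1)[OF xx(1)] by (elim exE conjE)
        have "y' \<notin> f'"
        proof
          assume "y' \<in> f'"
          then have "f' = {y, y'}"
            using simple_graph_edge[OF G(2) edge_answers f'(2) _ y(3)] z(1) f'(1) by simp
          then show False using z(2) f'(1) xx(3) by simp
        qed
        then have "\<not> hypiso_rule G1 G2 (edge_question {v, w}) (vertex_question x') z (vertex_answer y')"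
          using xx(2) by (simp add: hypiso_rule_incident(1) f'(1))
        then have "gen (edge_question {v, w}, z) * U x' y' \<in> game_ideal H"
          unfolding U_def by (intro null qa questions z)
        then show ?thesis using game_ideal_closed(4)[OF UF[OF xx(1) y(1)]] by (simp add: mult.assoc)
      qed
    qed (use answers in simp)
    then show ?thesis by (simp add: g_def)
  qed
  have right: "?cl g = ?cl (g * U x i + g * U x j)" if "x \<in> {v, w}" for x
  proof -
    have q: "vertex_question x \<in> questA H" using that questions by blast
    have "?cl (g * 1) = ?cl (\<Sum>z\<in>{vertex_answer i, vertex_answer j}. g * gen (vertex_question x, z) * 1)"
    proof (rule partition_of_unity[OF q fin _ gF free_algebra_one])
      fix z assume z: "z \<in> answA H" "z \<notin> {vertex_answer i, vertex_answer j}"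
      then have "\<not> hypiso_rule G1 G2 (edge_question {v, w}) (vertex_question x) (edge_answer {i, j}) z"
        using that by (auto simp: hypiso_rule_incident(2))
      then have "g * gen (vertex_question x, z) \<in> game_ideal H"
        unfolding g_def by (intro null q questions answers z)
      then show "g * gen (vertex_question x, z) * 1 \<in> game_ideal H" by simp
    qed (use answers in simp)
    then show ?thesis using f(2) by (simp add: U_def)
  qed
  have left: "?cl g = ?cl (U x i * g + U x j * g)" if "x \<in> {v, w}" for x
  proof -
    have q: "vertex_question x \<in> questA H" using that questions by blast
    have "?cl (1 * g) = ?cl (\<Sum>z\<in>{vertex_answer i, vertex_answer j}. 1 * gen (vertex_question x, z) * g)"
    proof (rule partition_of_unity[OF q fin _ free_algebra_one gF])
      fix z assume z: "z \<in> answA H" "z \<notin> {vertex_answer i, vertex_answer j}"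
      then have "\<not> hypiso_rule G1 G2 (vertex_question x) (edge_question {v, w}) z (edge_answer {i, j})"
        using that by (auto simp: hypiso_rule_incident_swapped(2))
      then have "gen (vertex_question x, z) * g \<in> game_ideal H"
        unfolding g_def by (intro null q questions answers z)
      then show "1 * gen (vertex_question x, z) * g \<in> game_ideal H" by simp
    qed (use answers in simp)
    then show ?thesis using f(2) by (simp add: U_def)
  qed
  have zero: "?cl h = \<zero>\<^bsub>game_algebra H\<^esub>" if "h \<in> game_ideal H" for h
  proof -
    have "?cl h = ?cl 0" using that by (simp add: game_class_eq_iff)
    also have "\<dots> = \<zero>\<^bsub>game_algebra H\<^esub>" by (simp add: game_class_eq game_algebra_def FactRing_def)
    finally show ?thesis .
  qed
  have orthogonal: "U x y * U x' y' \<in> game_ideal H"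
    if "x \<in> {v, w}" "x' \<in> {v, w}" "y \<in> {i, j}" "y' \<in> {i, j}" "(x = x') \<noteq> (y = y')" for x x' y y'
  proof -
    have "\<not> hypiso_rule G1 G2 (vertex_question x) (vertex_question x') (vertex_answer y) (vertex_answer y')"
      using that(5) by (auto simp: hypergraph_relation_def)
    then show ?thesis unfolding U_def using that questions answers by (intro null) auto
  qed
  have "?cl (U v i) \<otimes>\<^bsub>game_algebra H\<^esub> ?cl (U w j) = ?cl (U w j) \<otimes>\<^bsub>game_algebra H\<^esub> ?cl (U v i)"
  proof (rule commute_through_edge_element[where u' = "?cl (U v j)" and w' = "?cl (U w i)" and g = "?cl g"])
    note F = gF UF[of v i] UF[of v j] UF[of w i] UF[of w j]
    show "?cl (U v i) \<in> carrier (game_algebra H)" "?cl (U v j) \<in> carrier (game_algebra H)"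
      "?cl (U w i) \<in> carrier (game_algebra H)" "?cl (U w j) \<in> carrier (game_algebra H)"
      "?cl g \<in> carrier (game_algebra H)"
      using F by (simp_all add: game_class_closed)
    show "?cl g = ?cl g \<otimes>\<^bsub>game_algebra H\<^esub> ?cl (U v i) \<oplus>\<^bsub>game_algebra H\<^esub> ?cl g \<otimes>\<^bsub>game_algebra H\<^esub> ?cl (U v j)"
      using right[of v] F by (simp add: game_class_simps free_algebra_mult)
    show "?cl g = ?cl (U v i) \<otimes>\<^bsub>game_algebra H\<^esub> ?cl g \<oplus>\<^bsub>game_algebra H\<^esub> ?cl (U v j) \<otimes>\<^bsub>game_algebra H\<^esub> ?cl g"
      using left[of v] F by (simp add: game_class_simps free_algebra_mult)
    show "?cl g = ?cl g \<otimes>\<^bsub>game_algebra H\<^esub> ?cl (U w j) \<oplus>\<^bsub>game_algebra H\<^esub> ?cl g \<otimes>\<^bsub>game_algebra H\<^esub> ?cl (U w i)"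
      using right[of w, unfolded add.commute[of "g * U w i"]] F by (simp add: game_class_simps free_algebra_mult)
    show "?cl g = ?cl (U w j) \<otimes>\<^bsub>game_algebra H\<^esub> ?cl g \<oplus>\<^bsub>game_algebra H\<^esub> ?cl (U w i) \<otimes>\<^bsub>game_algebra H\<^esub> ?cl g"
      using left[of w, unfolded add.commute[of "U w i * g"]] F by (simp add: game_class_simps free_algebra_mult)
    show "?cl (U v i) \<otimes>\<^bsub>game_algebra H\<^esub> ?cl g \<otimes>\<^bsub>game_algebra H\<^esub> ?cl (U v j) = \<zero>\<^bsub>game_algebra H\<^esub>"
      using through_edge[of v v i j] zero[OF orthogonal[of v v i j]] f(2) F
      by (simp add: game_class_simps free_algebra_mult)
    show "?cl (U v j) \<otimes>\<^bsub>game_algebra H\<^esub> ?cl g \<otimes>\<^bsub>game_algebra H\<^esub> ?cl (U v i) = \<zero>\<^bsub>game_algebra H\<^esub>"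
      using through_edge[of v v j i] zero[OF orthogonal[of v v j i]] f(2) F
      by (simp add: game_class_simps free_algebra_mult insert_commute)
    show "?cl (U v i) \<otimes>\<^bsub>game_algebra H\<^esub> ?cl (U w i) = \<zero>\<^bsub>game_algebra H\<^esub>"
      using zero[OF orthogonal[of v w i i]] e(2) F by (simp add: game_class_simps)
    show "?cl (U w i) \<otimes>\<^bsub>game_algebra H\<^esub> ?cl (U v i) = \<zero>\<^bsub>game_algebra H\<^esub>"
      using zero[OF orthogonal[of w v i i]] e(2) F by (simp add: game_class_simps)
    show "?cl (U v i) \<otimes>\<^bsub>game_algebra H\<^esub> ?cl (U w j)
        = ?cl (U v i) \<otimes>\<^bsub>game_algebra H\<^esub> ?cl g \<otimes>\<^bsub>game_algebra H\<^esub> ?cl (U w j)"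
      using through_edge[of v w i j] F by (simp add: game_class_simps free_algebra_mult)
    show "?cl (U w j) \<otimes>\<^bsub>game_algebra H\<^esub> ?cl (U v i)
        = ?cl (U w j) \<otimes>\<^bsub>game_algebra H\<^esub> ?cl g \<otimes>\<^bsub>game_algebra H\<^esub> ?cl (U v i)"
      using through_edge[of w v j i] F by (simp add: game_class_simps free_algebra_mult insert_commute)
  qed
  then have "?cl (U v i * U w j) = ?cl (U w j * U v i)"
    using UF by (simp add: game_class_simps)
  then show ?thesis by (simp add: U_def)
qed

section \<open>A noncommutative representation of the graph game algebra\<close>

text \<open>Losing products must vanish in both orders because the ideal contains the adjoints of the
  relations.\<close>

lemma evaluate_game_ideal:
  assumes idem: "\<And>x a. \<lbrakk>x \<in> questA G; a \<in> answA G\<rbrakk> \<Longrightarrow> \<rho> (x, a) * \<rho> (x, a) = \<rho> (x, a)"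
    and total: "\<And>x. x \<in> questA G \<Longrightarrow> (\<Sum>a\<in>answA G. \<rho> (x, a)) = 1"
    and null: "\<And>x y a b. \<lbrakk>x \<in> questA G; y \<in> questA G; a \<in> answA G; b \<in> answA G; \<not> rule G x y a b\<rbrakk>
      \<Longrightarrow> \<rho> (x, a) * \<rho> (y, b) = 0 \<and> \<rho> (y, b) * \<rho> (x, a) = 0"
    and f: "f \<in> game_ideal G"
  shows "evaluate \<rho> f = 0"
proof -
  let ?J = "{f \<in> carrier (game_free_algebra G). evaluate \<rho> f = 0}"
  have "ideal ?J (game_free_algebra G)"
    by (rule free_algebra_idealI)
      (simp_all add: evaluate_zero evaluate_add evaluate_mult free_algebra_closed subset_iff)
  then have "game_ideal G \<subseteq> ?J"
  proof (rule game_ideal_least)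
    fix r assume r: "r \<in> game_relations G"
    then have "r \<in> carrier (game_free_algebra G)" using game_relations_closed by blast
    moreover have "evaluate \<rho> r = 0 \<and> evaluate \<rho> (star r) = 0"
      using r idem total null unfolding game_relations_def
      by (auto simp: evaluate_diff evaluate_mult evaluate_sum evaluate_gen evaluate_one
          star_mult star_gen star_diff star_sum star_one)
    ultimately show "r \<in> ?J \<and> star r \<in> ?J" by (simp add: free_algebra_star)
  qed
  then show ?thesis using f by blast
qed

text \<open>A left-zero semigroup with a unit adjoined.  Its monoid algebra is one of the smallest algebras with
  two noncommuting idempotents \<open>p\<close>, \<open>q\<close>: they satisfy \<open>p q = p\<close> and \<open>q p = q\<close>.  The absence of a compatible
  involution is harmless, since only membership in the game ideal is tested.\<close>

datatype band = Unit | First | Second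

instantiation band :: monoid_add
begin
definition zero_band :: band where "zero_band = Unit"
definition plus_band :: "band \<Rightarrow> band \<Rightarrow> band" where "plus_band x y = (if x = Unit then y else x)"
instance by standard (simp_all add: zero_band_def plus_band_def)
end

text \<open>The third block is the identity matrix; two noncommuting blocks suffice.\<close>

definition block_idempotent :: "nat \<Rightarrow> band \<Rightarrow>\<^sub>0 complex" where
  "block_idempotent k = (if k = 0 then Poly_Mapping.single First 1
     else if k = 1 then Poly_Mapping.single Second 1 else 1)"

lemma block_idempotent_square: "block_idempotent k * block_idempotent k = block_idempotent k"
  by (simp add: block_idempotent_def mult_single plus_band_def)

definition block_magic :: "nat \<Rightarrow> nat \<Rightarrow> band \<Rightarrow>\<^sub>0 complex" where
  "block_magic v w = (if v div 2 = w div 2 then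
     (if v = w then block_idempotent (v div 2) else 1 - block_idempotent (v div 2)) else 0)"

lemma block_magic_idempotent: "block_magic v w * block_magic v w = block_magic v w"
  by (simp add: block_magic_def block_idempotent_square algebra_simps)

lemma block_magic_sum:
  assumes "v < 6"
  shows "(\<Sum>w<6. block_magic v w) = 1" "(\<Sum>w<6. block_magic w v) = 1"
  using less_6_cases[OF assms] by (elim disjE; simp add: lessThan_6 block_magic_def)+

lemma block_magic_orthogonal:
  assumes "w \<noteq> w'"
  shows "block_magic v w * block_magic v w' = 0" "block_magic w v * block_magic w' v = 0"
proof -
  have one: "v = w \<or> v = w'" if "v div 2 = w div 2" "v div 2 = w' div 2"
    using same_half_cases[OF that] assms by blast
  have "block_magic v w * block_magic v w' = 0 \<and> block_magic w v * block_magic w' v = 0"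
  proof (cases "v div 2 = w div 2 \<and> v div 2 = w' div 2")
    case True
    from one True have "v = w \<or> v = w'" by blast
    then show ?thesis
    proof
      assume "v = w"
      then show ?thesis using True assms by (simp add: block_magic_def block_idempotent_square right_diff_distrib left_diff_distrib)
    next
      assume "v = w'"
      then show ?thesis using True assms by (simp add: block_magic_def block_idempotent_square right_diff_distrib left_diff_distrib)
    qed
  qed (auto simp: block_magic_def)
  then show "block_magic v w * block_magic v w' = 0" "block_magic w v * block_magic w' v = 0" by blast+
qed

definition block_representation :: "(nat + nat) \<times> (nat + nat) \<Rightarrow> band \<Rightarrow>\<^sub>0 complex" where
  "block_representation = (\<lambda>(x, a). case sides x a of None \<Rightarrow> 0 | Some (v, w) \<Rightarrow> block_magic v w)"

lemma block_representation_vanishes: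
  assumes "f \<in> game_ideal (Iso complete6 complete6)"
  shows "evaluate block_representation f = 0"
proof (rule evaluate_game_ideal[OF _ _ _ assms])
  let ?Q = "{..<6::nat} <+> {..<6::nat}"
  have Q: "questA (Iso complete6 complete6) = ?Q" "answA (Iso complete6 complete6) = ?Q"
    "rule (Iso complete6 complete6) = iso_rule complete6 complete6"
    by (simp_all add: Iso_def Let_def)
  fix x
  show "block_representation (x, a) * block_representation (x, a) = block_representation (x, a)" for a
    by (auto simp: block_representation_def block_magic_idempotent split: option.split)
  show "(\<Sum>a\<in>answA (Iso complete6 complete6). block_representation (x, a)) = 1"
    if "x \<in> questA (Iso complete6 complete6)"
    using that block_magic_sum by (auto simp: Q sum.Plus block_representation_def)
  fix y a b
  assume "x \<in> questA (Iso complete6 complete6)" "y \<in> questA (Iso complete6 complete6)"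
    "a \<in> answA (Iso complete6 complete6)" "b \<in> answA (Iso complete6 complete6)"
    and lose: "\<not> rule (Iso complete6 complete6) x y a b"
  then have in_Q: "x \<in> ?Q" "y \<in> ?Q" "a \<in> ?Q" "b \<in> ?Q" by (simp_all add: Q)
  show "block_representation (x, a) * block_representation (y, b) = 0 \<and>
      block_representation (y, b) * block_representation (x, a) = 0"
  proof (cases "sides x a = None \<or> sides y b = None")
    case True
    then show ?thesis by (auto simp: block_representation_def)
  next
    case False
    then obtain v w v' w' where s: "sides x a = Some (v, w)" "sides y b = Some (v', w')" by auto
    have bounds: "v < 6" "w < 6" "v' < 6" "w' < 6"
      using in_Q s by (auto elim!: PlusE)
    have "(v = v') \<noteq> (w = w')"
      using lose s iso_rule_complete6[OF bounds(1,3,2,4)] by (auto simp: Q iso_rule_def)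
    then show ?thesis
      using block_magic_orthogonal s by (auto simp: block_representation_def)
  qed
qed

text \<open>The entries at \<open>(0, 0)\<close> and \<open>(2, 2)\<close> lie in the two noncommuting blocks, and \<open>{0, 2}\<close> is an edge.\<close>

lemma canonical_map_not_injective:
  assumes "\<And>f. \<phi> (game_class (Iso complete6 complete6) f)
    = game_class (HypIso complete6 complete6) (relabel (map_prod Inl Inl) f)"
  shows "\<not> inj_on \<phi> (carrier (game_algebra (Iso complete6 complete6)))"
proof
  let ?I = "Iso complete6 complete6"
  assume inj: "inj_on \<phi> (carrier (game_algebra ?I))"
  define u where "u = gen (Inl 0 :: nat + nat, Inr 0 :: nat + nat)"
  define w where "w = gen (Inl 2 :: nat + nat, Inr 2 :: nat + nat)"
  have "u \<in> carrier (game_free_algebra ?I)" "w \<in> carrier (game_free_algebra ?I)"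
    unfolding u_def w_def by (simp_all add: generator_in_game_algebra Iso_def Let_def InlI InrI)
  then have closed: "u * w \<in> carrier (game_free_algebra ?I)" "w * u \<in> carrier (game_free_algebra ?I)"
    by (simp_all add: free_algebra_mult)
  have "\<phi> (game_class ?I (u * w)) = \<phi> (game_class ?I (w * u))"
    using HypIso_adjacent_entries_commute[OF simple_graph_complete6 simple_graph_complete6, of 0 2 0 2]
      edge_complete6[of 0 2]
    by (simp add: assms u_def w_def relabel_simps)
  then have "game_class ?I (u * w) = game_class ?I (w * u)"
    using inj_onD[OF inj] closed by (simp add: game_class_closed)
  then have "evaluate block_representation (u * w - w * u) = 0"
    by (intro block_representation_vanishes) (simp add: game_class_eq_iff)
  then have "block_idempotent 0 * block_idempotent 1 = block_idempotent 1 * block_idempotent 0"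
    by (simp add: evaluate_diff evaluate_mult u_def w_def evaluate_gen block_representation_def block_magic_def)
  then have "Poly_Mapping.single First (1::complex) = Poly_Mapping.single Second 1"
    by (simp add: block_idempotent_def mult_single plus_band_def)
  then have "Poly_Mapping.lookup (Poly_Mapping.single First (1::complex)) First
      = Poly_Mapping.lookup (Poly_Mapping.single Second 1) First" by simp
  then show False by (simp add: lookup_single when_def)
qed

section \<open>The separation of the two games\<close>

theorem proposition3p14:
  shows "\<exists>(G1 :: nat hgraph) (G2 :: nat hgraph).
    simple_graph G1 \<and> hypergraph G1 \<and> simple_graph G2 \<and> hypergraph G2 \<and>
    (\<exists>\<phi>. canonical_iso_hypiso_map G1 G2 \<phi> \<and>
          \<not> inj_on \<phi> (carrier (game_algebra (Iso G1 G2)))) \<and>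
    (\<exists>p. perfect_q_strategy (Iso G1 G2) p \<and> \<not> perfect_q_strategy_for_HypIso G1 G2 p)"
proof (intro exI[of _ complete6] conjI)
  show "\<exists>\<phi>. canonical_iso_hypiso_map complete6 complete6 \<phi> \<and>
      \<not> inj_on \<phi> (carrier (game_algebra (Iso complete6 complete6)))"
    using canonical_map_exists[OF simple_graph_complete6 simple_graph_complete6]
      canonical_map_not_injective by metis
  show "\<exists>p. perfect_q_strategy (Iso complete6 complete6) p \<and>
      \<not> perfect_q_strategy_for_HypIso complete6 complete6 p"
    using block_strategy_perfect block_strategy_not_for_HypIso by blast
qed (simp_all add: simple_graph_complete6 hypergraph_complete6)

end
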